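(* Let $m$ be a measure on an unbounded pseudo-BCK algebra $A$ that is a downwards-directed set. Then the operations $\rightarrow/\mathrm{Ker}_0(m)$ and $\rightsquigarrow/\mathrm{Ker}_0(m)$ on $A/\mathrm{Ker}_0(m)$ coincide. Moreover, there is a unique (up to isomorphism) archimedean $\ell$-group $G$ such that $A/\mathrm{Ker}_0(m)$ is a subalgebra of the pseudo-BCK algebra $G^-$ and $A/\mathrm{Ker}_0(m)$ generates the $\ell$-group $G$.
   Context: A pseudo-BCK algebra is a structure $(A,\le,\rightarrow,\rightsquigarrow,1)$ with $\le$ a binary relation, $\rightarrow,\rightsquigarrow$ binary operations and $1\in A$, such that for all $x,y,z\in A$: $x\rightarrow y\le (y\rightarrow z)\rightsquigarrow(x\rightarrow z)$ and $x\rightsquigarrow y\le (y\rightsquigarrow z)\rightarrow(x\rightsquigarrow z)$; $x\le (x\rightarrow y)\rightsquigarrow y$ and $x\le (x\rightsquigarrow y)\rightarrow y$; $x\le x$; $x\le 1$; antisymmetry of $\le$; $x\le y$ iff $x\rightarrow y=1$ iff $x\rightsquigarrow y=1$. It is unbounded if it has no least element. $A$ is downwards-directed if for all $a,b\in A$ there is $x\in A$ with $x\le a$, $x\le b$. A measure on $A$ is a map $m:A\to[0,\infty)$ with $m(x\rightarrow y)=m(x\rightsquigarrow y)=m(y)-m(x)$ whenever $y\le x$; $\mathrm{Ker}_0(m)=\{x: m(x)=0\}$ is a normal filter (a set $F\ni1$ with $a,a\rightarrow b\in F\Rightarrow b\in F$, and $a\rightarrow b\in F\iff a\rightsquigarrow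 b\in F$), and $A/\mathrm{Ker}_0(m)$ is the quotient by the congruence $a\Theta b\iff a\rightarrow b,\,b\rightarrow a\in\mathrm{Ker}_0(m)$. For an $\ell$-group $G$ (lattice-ordered group, not necessarily abelian), its negative cone $G^-=\{g\le 0\}$ is a pseudo-BCK algebra with $g\rightarrow h=(h-g)\wedge 0$, $g\rightsquigarrow h=(-g+h)\wedge 0$, top element $0$. *)

theory Defs
  imports Complex_Main "HOL-Algebra.Group" "HOL-Algebra.Lattice"
begin

section \<open>Pseudo-BCK algebras\<close>

record 'a pbck = "'a partial_object" +
  ple :: "'a \<Rightarrow> 'a \<Rightarrow> bool" (infixl \<open>\<preceq>\<index>\<close> 50)
  pimp :: "'a \<Rightarrow> 'a \<Rightarrow> 'a" (infixr \<open>\<^bold>\<rightarrow>\<index>\<close> 60)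
  psimp :: "'a \<Rightarrow> 'a \<Rightarrow> 'a" (infixr \<open>\<leadsto>\<index>\<close> 60)
  ptop :: 'a (\<open>\<^bold>1\<index>\<close>)

locale pseudo_bck =
  fixes A (structure)
  assumes top_closed: "\<^bold>1 \<in> carrier A"
    and imp_closed: "\<lbrakk>x \<in> carrier A; y \<in> carrier A\<rbrakk> \<Longrightarrow> x \<^bold>\<rightarrow> y \<in> carrier A"
    and simp_closed: "\<lbrakk>x \<in> carrier A; y \<in> carrier A\<rbrakk> \<Longrightarrow> x \<leadsto> y \<in> carrier A"
    and imp_trans: "\<lbrakk>x \<in> carrier A; y \<in> carrier A; z \<in> carrier A\<rbrakk>
      \<Longrightarrow> x \<^bold>\<rightarrow> y \<preceq> (y \<^bold>\<rightarrow> z) \<leadsto> (x \<^bold>\<rightarrow> z)"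
    and simp_trans: "\<lbrakk>x \<in> carrier A; y \<in> carrier A; z \<in> carrier A\<rbrakk>
      \<Longrightarrow> x \<leadsto> y \<preceq> (y \<leadsto> z) \<^bold>\<rightarrow> (x \<leadsto> z)"
    and imp_simp: "\<lbrakk>x \<in> carrier A; y \<in> carrier A\<rbrakk> \<Longrightarrow> x \<preceq> (x \<^bold>\<rightarrow> y) \<leadsto> y"
    and simp_imp: "\<lbrakk>x \<in> carrier A; y \<in> carrier A\<rbrakk> \<Longrightarrow> x \<preceq> (x \<leadsto> y) \<^bold>\<rightarrow> y"
    and refl: "x \<in> carrier A \<Longrightarrow> x \<preceq> x"
    and le_top: "x \<in> carrier A \<Longrightarrow> x \<preceq> \<^bold>1"
    and antisym: "\<lbrakk>x \<in> carrier A; y \<in> carrier A; x \<preceq> y; y \<preceq> x\<rbrakk> \<Longrightarrow> x = y"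
    and le_iff_imp: "\<lbrakk>x \<in> carrier A; y \<in> carrier A\<rbrakk> \<Longrightarrow> x \<preceq> y \<longleftrightarrow> x \<^bold>\<rightarrow> y = \<^bold>1"
    and le_iff_simp: "\<lbrakk>x \<in> carrier A; y \<in> carrier A\<rbrakk> \<Longrightarrow> x \<preceq> y \<longleftrightarrow> x \<leadsto> y = \<^bold>1"

definition unbounded :: "('a, 'b) pbck_scheme \<Rightarrow> bool" where
  "unbounded A \<longleftrightarrow> \<not> (\<exists>z\<in>carrier A. \<forall>x\<in>carrier A. z \<preceq>\<^bsub>A\<^esub> x)"

definition downwards_directed :: "('a, 'b) pbck_scheme \<Rightarrow> bool" where
  "downwards_directed A \<longleftrightarrow>
    (\<forall>a\<in>carrier A. \<forall>b\<in>carrier A. \<exists>x\<in>carrier A. x \<preceq>\<^bsub>A\<^esub> a \<and> x \<preceq>\<^bsub>A\<^esub> b)"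

definition bck_measure :: "('a, 'b) pbck_scheme \<Rightarrow> ('a \<Rightarrow> real) \<Rightarrow> bool" where
  "bck_measure A m \<longleftrightarrow>
    (\<forall>x\<in>carrier A. 0 \<le> m x) \<and>
    (\<forall>x\<in>carrier A. \<forall>y\<in>carrier A. y \<preceq>\<^bsub>A\<^esub> x \<longrightarrow>
      m (x \<^bold>\<rightarrow>\<^bsub>A\<^esub> y) = m y - m x \<and> m (x \<leadsto>\<^bsub>A\<^esub> y) = m y - m x)"

definition Ker0 :: "('a, 'b) pbck_scheme \<Rightarrow> ('a \<Rightarrow> real) \<Rightarrow> 'a set" where
  "Ker0 A m = {x \<in> carrier A. m x = 0}"

definition Theta :: "('a, 'b) pbck_scheme \<Rightarrow> 'a set \<Rightarrow> ('a \<times> 'a) set" where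
  "Theta A F = {(a, b). a \<in> carrier A \<and> b \<in> carrier A \<and>
    a \<^bold>\<rightarrow>\<^bsub>A\<^esub> b \<in> F \<and> b \<^bold>\<rightarrow>\<^bsub>A\<^esub> a \<in> F}"

text \<open>Meaningful when \<open>F\<close> is a normal filter: then \<open>Theta A F\<close> is a congruence, and each union
  below is the single class of \<open>x \<^bold>\<rightarrow> y\<close> (resp. \<open>x \<leadsto> y\<close>) for any representatives \<open>x\<close>, \<open>y\<close>.\<close>

definition pbck_quot :: "('a, 'b) pbck_scheme \<Rightarrow> 'a set \<Rightarrow> 'a set pbck" where
  "pbck_quot A F =
    (let imp = (\<lambda>X Y. \<Union>x\<in>X. \<Union>y\<in>Y. Theta A F `` {x \<^bold>\<rightarrow>\<^bsub>A\<^esub> y});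
         simp = (\<lambda>X Y. \<Union>x\<in>X. \<Union>y\<in>Y. Theta A F `` {x \<leadsto>\<^bsub>A\<^esub> y});
         top = Theta A F `` {\<^bold>1\<^bsub>A\<^esub>}
     in \<lparr>carrier = carrier A // Theta A F,
         ple = (\<lambda>X Y. imp X Y = top),
         pimp = imp, psimp = simp, ptop = top\<rparr>)"

text \<open>An isomorphism of \<open>B\<close> onto a subalgebra of \<open>C\<close>.\<close>

definition pbck_embedding ::
  "('a, 'c) pbck_scheme \<Rightarrow> ('b, 'd) pbck_scheme \<Rightarrow> ('a \<Rightarrow> 'b) \<Rightarrow> bool" where
  "pbck_embedding B C e \<longleftrightarrow>
    e ` carrier B \<subseteq> carrier C \<and> inj_on e (carrier B) \<and> e \<^bold>1\<^bsub>B\<^esub> = \<^bold>1\<^bsub>C\<^esub> \<and>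
    (\<forall>x\<in>carrier B. \<forall>y\<in>carrier B.
      e (x \<^bold>\<rightarrow>\<^bsub>B\<^esub> y) = e x \<^bold>\<rightarrow>\<^bsub>C\<^esub> e y \<and>
      e (x \<leadsto>\<^bsub>B\<^esub> y) = e x \<leadsto>\<^bsub>C\<^esub> e y \<and>
      (x \<preceq>\<^bsub>B\<^esub> y \<longleftrightarrow> e x \<preceq>\<^bsub>C\<^esub> e y))"


section \<open>Lattice-ordered groups\<close>

text \<open>Groups are written multiplicatively, as in HOL-Algebra: \<open>g + h\<close>, \<open>- g\<close>, \<open>0\<close> become
  \<open>g \<otimes> h\<close>, \<open>inv g\<close>, \<open>\<one>\<close>.\<close>

record 'a ogroup = "'a monoid" +
  ogle :: "'a \<Rightarrow> 'a \<Rightarrow> bool" (infixl \<open>\<unlhd>\<index>\<close> 50)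

definition ord_of :: "('a, 'b) ogroup_scheme \<Rightarrow> 'a gorder" where
  "ord_of G = \<lparr>carrier = carrier G, eq = (=), le = ogle G\<rparr>"

locale l_group = group G for G (structure) +
  assumes lattice_order: "lattice (ord_of G)"
    and mult_mono: "\<lbrakk>g \<in> carrier G; h \<in> carrier G; a \<in> carrier G; b \<in> carrier G; g \<unlhd> h\<rbrakk>
      \<Longrightarrow> a \<otimes> g \<otimes> b \<unlhd> a \<otimes> h \<otimes> b"

locale archimedean_l_group = l_group G for G (structure) +
  assumes archimedean: "\<lbrakk>g \<in> carrier G; h \<in> carrier G; \<one> \<unlhd> g; \<one> \<unlhd> h;
      \<And>n::nat. g [^] n \<unlhd> h\<rbrakk> \<Longrightarrow> g = \<one>"

definition neg_cone :: "('a, 'b) ogroup_scheme \<Rightarrow> 'a pbck" where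
  "neg_cone G =
    \<lparr>carrier = {g \<in> carrier G. g \<unlhd>\<^bsub>G\<^esub> \<one>\<^bsub>G\<^esub>},
     ple = ogle G,
     pimp = (\<lambda>g h. (h \<otimes>\<^bsub>G\<^esub> inv\<^bsub>G\<^esub> g) \<sqinter>\<^bsub>ord_of G\<^esub> \<one>\<^bsub>G\<^esub>),
     psimp = (\<lambda>g h. (inv\<^bsub>G\<^esub> g \<otimes>\<^bsub>G\<^esub> h) \<sqinter>\<^bsub>ord_of G\<^esub> \<one>\<^bsub>G\<^esub>),
     ptop = \<one>\<^bsub>G\<^esub>\<rparr>"

definition l_subgroup :: "'a set \<Rightarrow> ('a, 'b) ogroup_scheme \<Rightarrow> bool" where
  "l_subgroup H G \<longleftrightarrow> subgroup H G \<and>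
    (\<forall>g\<in>H. \<forall>h\<in>H. g \<sqinter>\<^bsub>ord_of G\<^esub> h \<in> H \<and> g \<squnion>\<^bsub>ord_of G\<^esub> h \<in> H)"

definition l_generates :: "'a set \<Rightarrow> ('a, 'b) ogroup_scheme \<Rightarrow> bool" where
  "l_generates S G \<longleftrightarrow> \<Inter>{H. l_subgroup H G \<and> S \<subseteq> H} = carrier G"

definition l_iso :: "('a, 'c) ogroup_scheme \<Rightarrow> ('b, 'd) ogroup_scheme \<Rightarrow> ('a \<Rightarrow> 'b) set" where
  "l_iso G H = {f \<in> iso G H. \<forall>g\<in>carrier G. \<forall>h\<in>carrier G.
    f (g \<sqinter>\<^bsub>ord_of G\<^esub> h) = f g \<sqinter>\<^bsub>ord_of H\<^esub> f h \<and>
    f (g \<squnion>\<^bsub>ord_of G\<^esub> h) = f g \<squnion>\<^bsub>ord_of H\<^esub> f h}"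

text \<open>\<open>e\<close> identifies \<open>B\<close> with a subalgebra of \<open>neg_cone G\<close> that generates the archimedean
  \<open>\<ell>\<close>-group \<open>G\<close>.\<close>

definition arch_l_envelope ::
  "('a, 'c) pbck_scheme \<Rightarrow> ('b, 'd) ogroup_scheme \<Rightarrow> ('a \<Rightarrow> 'b) \<Rightarrow> bool" where
  "arch_l_envelope B G e \<longleftrightarrow>
    archimedean_l_group G \<and> pbck_embedding B (neg_cone G) e \<and> l_generates (e ` carrier B) G"

text \<open>A carrier type for the \<open>\<ell>\<close>-group: an \<open>\<ell>\<close>-group generated by a set of elements of type \<open>'q\<close>
  has at most as many elements as there are lists over \<open>'q\<close>, so up to isomorphism it lives on
  classes of formal differences of finite sums over \<open>'q\<close>.\<close>

type_synonym 'q diff_class = "('q list \<times> 'q list) set"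

end

theory Submission
  imports Defs "HOL-Library.Function_Algebras"
begin

text \<open>On the quotient the measure vanishes only at the top, so \<open>y \<preceq> x\<close> gives
  \<open>(x \<^bold>\<rightarrow> y) \<leadsto> y = x\<close>: the quotient is a join-semilattice, and directedness makes
  \<open>x \<^bold>\<rightarrow> y\<close> and \<open>y \<^bold>\<rightarrow> x\<close> disjoint. For each \<open>p\<close> the part of the measure
  supported by \<open>p\<close>, obtained from a limit of the iterates of \<open>\<lambda>x. p \<^bold>\<rightarrow> x\<close>, is again a measure.
  These measures separate points and do not change under conjugation, which forces the two
  implications to coincide. They also embed the quotient additively into real-valued functions
  with the pointwise order. The subgroup generated by the image is archimedean and it is a lattice,
  because every formal difference of sums can be rewritten as one with mutually disjoint parts.
  The same rewriting takes place in any other \<open>\<ell>\<close>-group generated by the quotient, which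
  is commutative since its generators commute; this gives the isomorphism.\<close>

section \<open>Arithmetic of pseudo-BCK algebras\<close>

text \<open>The measure itself tells apart only comparable elements, and a conjugate of x is not
  known in advance to be comparable with x; hence the whole family of measures indexed by p. In a
  negative cone, n applications of p \<rightarrow> turn x into (x - n p) \<sqinter> 0, so what p
  supports is peeled off and the part of x disjoint from p remains. The iteration uses only one of
  the arrows. That the other arrow yields the same limit follows from a description of the limit as
  a greatest one, in terms of the order, joins and the measure. Two elements are disjoint when their
  join is 1. The functions \<open>lam p\<close> are additive but need not respect meets, so the meet
  in the enveloping group is not the pointwise minimum, which may even leave the group. Infima must
  be found inside the group of differences. What makes this possible is the evaluation of a sum at
  one of its own entries d: there d contributes its full measure, and everything disjoint from d
  contributes nothing.\<close>

definition pbck_dual :: "'a pbck \<Rightarrow> 'a pbck" where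
  "pbck_dual A = A\<lparr>pimp := psimp A, psimp := pimp A\<rparr>"

lemma pbck_dual_simps [simp]:
  "carrier (pbck_dual A) = carrier A" "ple (pbck_dual A) = ple A"
  "pimp (pbck_dual A) = psimp A" "psimp (pbck_dual A) = pimp A" "ptop (pbck_dual A) = ptop A"
  by (simp_all add: pbck_dual_def)

text \<open>The axioms come in pairs exchanged by swapping the arrows. Interpreting a locale at the
  dual therefore yields the mirror image of a lemma proved for one arrow.\<close>

lemma pseudo_bck_dual: "pseudo_bck A \<Longrightarrow> pseudo_bck (pbck_dual A)"
  unfolding pseudo_bck_def pbck_dual_simps by (elim conjE) (intro conjI)

lemma bck_measure_dual: "bck_measure A m \<Longrightarrow> bck_measure (pbck_dual A) m"
  unfolding bck_measure_def by simp

context pseudo_bck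
begin

declare top_closed [simp] imp_closed [simp] simp_closed [simp]

lemma top_le: "x \<in> carrier A \<Longrightarrow> \<^bold>1 \<preceq> x \<Longrightarrow> x = \<^bold>1"
  using antisym le_top top_closed by blast

lemma trans:
  assumes "x \<in> carrier A" "y \<in> carrier A" "z \<in> carrier A" "x \<preceq> y" "y \<preceq> z"
  shows "x \<preceq> z"
proof -
  \<comment> \<open>\<open>top_simp\<close> rests on transitivity, so 1 \<leadsto> u cannot be
    simplified yet; \<open>top_le\<close> is used at both levels instead.\<close>
  have "\<^bold>1 \<preceq> \<^bold>1 \<leadsto> (x \<^bold>\<rightarrow> z)"
    using assms imp_trans[of x y z] le_iff_imp[of x y] le_iff_imp[of y z] by simp
  then have "\<^bold>1 \<leadsto> (x \<^bold>\<rightarrow> z) = \<^bold>1" by (intro top_le) (simp_all add: assms)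
  then have "\<^bold>1 \<preceq> x \<^bold>\<rightarrow> z" using assms le_iff_simp by simp
  then show ?thesis using assms top_le[of "x \<^bold>\<rightarrow> z"] le_iff_imp by simp
qed

lemma imp_anti:
  assumes "x \<in> carrier A" "y \<in> carrier A" "z \<in> carrier A" "x \<preceq> y"
  shows "y \<^bold>\<rightarrow> z \<preceq> x \<^bold>\<rightarrow> z"
proof -
  have "\<^bold>1 \<preceq> (y \<^bold>\<rightarrow> z) \<leadsto> (x \<^bold>\<rightarrow> z)"
    using assms imp_trans[of x y z] le_iff_imp[of x y] by simp
  then show ?thesis using assms top_le[of "(y \<^bold>\<rightarrow> z) \<leadsto> (x \<^bold>\<rightarrow> z)"] le_iff_simp by simp
qed

lemma simp_anti:
  assumes "x \<in> carrier A" "y \<in> carrier A" "z \<in> carrier A" "x \<preceq> y"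
  shows "y \<leadsto> z \<preceq> x \<leadsto> z"
proof -
  have "\<^bold>1 \<preceq> (y \<leadsto> z) \<^bold>\<rightarrow> (x \<leadsto> z)"
    using assms simp_trans[of x y z] le_iff_simp[of x y] by simp
  then show ?thesis using assms top_le[of "(y \<leadsto> z) \<^bold>\<rightarrow> (x \<leadsto> z)"] le_iff_imp by simp
qed

text \<open>An antitone Galois connection with \<open>imp_simp\<close> and \<open>simp_imp\<close>
  as its units; \<open>imp_simp_imp\<close> is the usual triple law of such a connection.\<close>

lemma adj:
  assumes "x \<in> carrier A" "y \<in> carrier A" "z \<in> carrier A"
  shows "x \<preceq> y \<^bold>\<rightarrow> z \<longleftrightarrow> y \<preceq> x \<leadsto> z"
proof
  assume "x \<preceq> y \<^bold>\<rightarrow> z"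
  then have "(y \<^bold>\<rightarrow> z) \<leadsto> z \<preceq> x \<leadsto> z" using assms by (simp add: simp_anti)
  then show "y \<preceq> x \<leadsto> z"
    using assms trans[of y "(y \<^bold>\<rightarrow> z) \<leadsto> z"] by (simp add: imp_simp)
next
  assume "y \<preceq> x \<leadsto> z"
  then have "(x \<leadsto> z) \<^bold>\<rightarrow> z \<preceq> y \<^bold>\<rightarrow> z" using assms by (simp add: imp_anti)
  then show "x \<preceq> y \<^bold>\<rightarrow> z"
    using assms trans[of x "(x \<leadsto> z) \<^bold>\<rightarrow> z"] by (simp add: simp_imp)
qed

lemma imp_imp:
  assumes "x \<in> carrier A" "y \<in> carrier A" "z \<in> carrier A"
  shows "y \<^bold>\<rightarrow> z \<preceq> (x \<^bold>\<rightarrow> y) \<^bold>\<rightarrow> (x \<^bold>\<rightarrow> z)"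
  using assms adj[THEN iffD2] imp_trans by simp

lemma simp_simp:
  assumes "x \<in> carrier A" "y \<in> carrier A" "z \<in> carrier A"
  shows "y \<leadsto> z \<preceq> (x \<leadsto> y) \<leadsto> (x \<leadsto> z)"
  using assms adj[THEN iffD1] simp_trans by simp

lemma imp_mono:
  assumes "x \<in> carrier A" "y \<in> carrier A" "z \<in> carrier A" "y \<preceq> z"
  shows "x \<^bold>\<rightarrow> y \<preceq> x \<^bold>\<rightarrow> z"
  using assms imp_imp[of x y z] top_le[of "(x \<^bold>\<rightarrow> y) \<^bold>\<rightarrow> (x \<^bold>\<rightarrow> z)"]
  by (simp add: le_iff_imp imp_closed)

lemma le_imp:
  assumes "x \<in> carrier A" "y \<in> carrier A"
  shows "y \<preceq> x \<^bold>\<rightarrow> y"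
  using assms adj[of y x y] le_top[of x] le_iff_simp[of y y] refl[of y] by simp

lemma le_simp:
  assumes "x \<in> carrier A" "y \<in> carrier A"
  shows "y \<preceq> x \<leadsto> y"
  using assms adj[of x y y] le_top[of x] le_iff_imp[of y y] refl[of y] by simp

lemma top_imp: "x \<in> carrier A \<Longrightarrow> \<^bold>1 \<^bold>\<rightarrow> x = x"
  using imp_simp[of "\<^bold>1" x] top_le[of "(\<^bold>1 \<^bold>\<rightarrow> x) \<leadsto> x"] le_iff_simp[of "\<^bold>1 \<^bold>\<rightarrow> x" x]
    le_imp[of "\<^bold>1" x] antisym[of "\<^bold>1 \<^bold>\<rightarrow> x" x] imp_closed simp_closed top_closed
  by simp

lemma top_simp: "x \<in> carrier A \<Longrightarrow> \<^bold>1 \<leadsto> x = x"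
  using simp_imp[of "\<^bold>1" x] top_le[of "(\<^bold>1 \<leadsto> x) \<^bold>\<rightarrow> x"] le_iff_imp[of "\<^bold>1 \<leadsto> x" x]
    le_simp[of "\<^bold>1" x] antisym[of "\<^bold>1 \<leadsto> x" x] imp_closed simp_closed top_closed
  by simp

lemma imp_top: "x \<in> carrier A \<Longrightarrow> x \<^bold>\<rightarrow> \<^bold>1 = \<^bold>1"
  using le_iff_imp le_top top_closed by blast

lemma imp_refl: "x \<in> carrier A \<Longrightarrow> x \<^bold>\<rightarrow> x = \<^bold>1"
  using le_iff_imp refl by blast

text \<open>In a group, \<rightarrow> comes from right translations and \<leadsto> from left
  translations, and these commute.\<close>

lemma exchange:
  assumes "x \<in> carrier A" "y \<in> carrier A" "z \<in> carrier A"
  shows "x \<^bold>\<rightarrow> (y \<leadsto> z) = y \<leadsto> (x \<^bold>\<rightarrow> z)"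
proof (rule antisym)
  have "y \<preceq> (x \<^bold>\<rightarrow> (y \<leadsto> z)) \<^bold>\<rightarrow> (x \<^bold>\<rightarrow> z)"
    using assms imp_imp[of x "y \<leadsto> z" z] simp_imp[of y z]
      trans[of y "(y \<leadsto> z) \<^bold>\<rightarrow> z" "(x \<^bold>\<rightarrow> (y \<leadsto> z)) \<^bold>\<rightarrow> (x \<^bold>\<rightarrow> z)"] by simp
  then show "x \<^bold>\<rightarrow> (y \<leadsto> z) \<preceq> y \<leadsto> (x \<^bold>\<rightarrow> z)" using assms by (simp add: adj)
  have "x \<preceq> (y \<leadsto> (x \<^bold>\<rightarrow> z)) \<leadsto> (y \<leadsto> z)"
    using assms simp_simp[of y "x \<^bold>\<rightarrow> z" z] imp_simp[of x z]
      trans[of x "(x \<^bold>\<rightarrow> z) \<leadsto> z" "(y \<leadsto> (x \<^bold>\<rightarrow> z)) \<leadsto> (y \<leadsto> z)"] by simp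
  then show "y \<leadsto> (x \<^bold>\<rightarrow> z) \<preceq> x \<^bold>\<rightarrow> (y \<leadsto> z)" using assms by (simp add: adj)
qed (use assms in simp_all)

lemma imp_simp_imp:
  assumes "x \<in> carrier A" "y \<in> carrier A"
  shows "((x \<^bold>\<rightarrow> y) \<leadsto> y) \<^bold>\<rightarrow> y = x \<^bold>\<rightarrow> y"
  using assms imp_anti[of x "(x \<^bold>\<rightarrow> y) \<leadsto> y" y] imp_simp simp_imp[of "x \<^bold>\<rightarrow> y" y]
  by (intro antisym) (simp_all add: imp_closed simp_closed)

end

section \<open>The quotient by the kernel of a measure\<close>

locale measured_pbck = pseudo_bck A for A :: "'a pbck" (structure) +
  fixes m :: "'a \<Rightarrow> real"
  assumes measure: "bck_measure A m"
begin

lemma measure_nonneg: "x \<in> carrier A \<Longrightarrow> 0 \<le> m x"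
  using measure unfolding bck_measure_def by blast

lemma measure_imp: "x \<in> carrier A \<Longrightarrow> y \<in> carrier A \<Longrightarrow> y \<preceq> x \<Longrightarrow> m (x \<^bold>\<rightarrow> y) = m y - m x"
  and measure_simp: "x \<in> carrier A \<Longrightarrow> y \<in> carrier A \<Longrightarrow> y \<preceq> x \<Longrightarrow> m (x \<leadsto> y) = m y - m x"
  using measure unfolding bck_measure_def by blast+

lemma measure_anti: "x \<in> carrier A \<Longrightarrow> y \<in> carrier A \<Longrightarrow> y \<preceq> x \<Longrightarrow> m x \<le> m y"
  using measure_imp measure_nonneg imp_closed by (metis diff_ge_0_iff_ge)

lemma measure_top: "m \<^bold>1 = 0"
  using measure_imp[of "\<^bold>1" "\<^bold>1"] refl[of "\<^bold>1"] top_closed imp_refl by simp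

text \<open>The measure axiom speaks only of comparable pairs. Replacing x by (x \<rightarrow> y)
  \<leadsto> y, which lies above y and has the same implication into y, makes it apply to all x and
  y.\<close>

lemma measure_imp':
  assumes "x \<in> carrier A" "y \<in> carrier A"
  shows "m (x \<^bold>\<rightarrow> y) = m y - m ((x \<^bold>\<rightarrow> y) \<leadsto> y)"
  using measure_imp[of "(x \<^bold>\<rightarrow> y) \<leadsto> y" y] imp_simp_imp assms imp_closed simp_closed le_simp by simp

text \<open>Half of the normality of the kernel. From \<open>?u\<close>, which lies above y, the two
  arrows into y have equal measure, and x \<preceq> \<open>?u\<close> bounds the measure of x
  \<leadsto> y by that of \<open>?u\<close> \<leadsto> y.\<close>

lemma imp_null_simp_null:
  assumes "x \<in> carrier A" "y \<in> carrier A" "m (x \<^bold>\<rightarrow> y) = 0"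
  shows "m (x \<leadsto> y) = 0"
proof -
  let ?u = "(x \<^bold>\<rightarrow> y) \<leadsto> y"
  have "m (?u \<leadsto> y) = 0"
    using measure_simp[of ?u y] measure_imp' assms imp_closed simp_closed le_simp by simp
  moreover have "m (x \<leadsto> y) \<le> m (?u \<leadsto> y)"
    using assms measure_anti simp_anti imp_simp imp_closed simp_closed by simp
  ultimately show ?thesis using measure_nonneg assms simp_closed by (metis order_antisym)
qed

lemma dual_measured: "measured_pbck (pbck_dual A) m"
  by (simp add: measured_pbck_def measured_pbck_axioms_def pseudo_bck_dual bck_measure_dual measure pseudo_bck_axioms)

lemma imp_null_iff_simp_null:
  assumes "x \<in> carrier A" "y \<in> carrier A"
  shows "m (x \<^bold>\<rightarrow> y) = 0 \<longleftrightarrow> m (x \<leadsto> y) = 0"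
  using imp_null_simp_null measured_pbck.imp_null_simp_null[OF dual_measured] assms by auto

definition null_le :: "'a \<Rightarrow> 'a \<Rightarrow> bool" where "null_le x y \<longleftrightarrow> m (x \<^bold>\<rightarrow> y) = 0"

lemma null_up: "x \<in> carrier A \<Longrightarrow> y \<in> carrier A \<Longrightarrow> x \<preceq> y \<Longrightarrow> m x = 0 \<Longrightarrow> m y = 0"
  using measure_anti measure_nonneg by (metis order_antisym)

lemma le_null_le: "x \<in> carrier A \<Longrightarrow> y \<in> carrier A \<Longrightarrow> x \<preceq> y \<Longrightarrow> null_le x y"
  using le_iff_imp measure_top null_le_def by auto

lemma null_le_measure:
  assumes "x \<in> carrier A" "y \<in> carrier A" "null_le x y" shows "m y \<le> m x"
  using assms measure_imp'[of x y] measure_anti[of "(x \<^bold>\<rightarrow> y) \<leadsto> y" x] imp_simp imp_closed simp_closed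
  unfolding null_le_def by simp

lemma null_le_trans:
  assumes "x \<in> carrier A" "y \<in> carrier A" "z \<in> carrier A" "null_le x y" "null_le y z"
  shows "null_le x z"
proof -
  have "m ((y \<^bold>\<rightarrow> z) \<leadsto> (x \<^bold>\<rightarrow> z)) = 0"
    using null_up assms imp_trans null_le_def imp_closed simp_closed by metis
  \<comment> \<open>The axiom delivers \<leadsto> as the outer arrow, while \<open>null_le\<close>
    is defined by \<rightarrow>; normality of the kernel converts.\<close>
  then have "null_le (y \<^bold>\<rightarrow> z) (x \<^bold>\<rightarrow> z)"
    unfolding null_le_def using imp_null_iff_simp_null assms imp_closed by simp
  then show ?thesis using null_le_measure[of "y \<^bold>\<rightarrow> z" "x \<^bold>\<rightarrow> z"] assms measure_nonneg imp_closed
    unfolding null_le_def by (metis order_antisym)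
qed

lemma null_le_imp_mono:
  assumes "x \<in> carrier A" "y \<in> carrier A" "z \<in> carrier A" "null_le y z"
  shows "null_le (x \<^bold>\<rightarrow> y) (x \<^bold>\<rightarrow> z)"
  using null_up[of "y \<^bold>\<rightarrow> z"] assms imp_imp imp_closed unfolding null_le_def by simp

lemma null_le_imp_anti:
  assumes "x \<in> carrier A" "y \<in> carrier A" "z \<in> carrier A" "null_le x y"
  shows "null_le (y \<^bold>\<rightarrow> z) (x \<^bold>\<rightarrow> z)"
  using null_up[of "x \<^bold>\<rightarrow> y" "(y \<^bold>\<rightarrow> z) \<leadsto> (x \<^bold>\<rightarrow> z)"] assms imp_trans imp_closed simp_closed
  unfolding null_le_def by (simp add: imp_null_iff_simp_null)

lemma null_le_imp_cong:
  assumes "x \<in> carrier A" "y \<in> carrier A" "x' \<in> carrier A" "y' \<in> carrier A" "null_le x' x" "null_le y y'"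
  shows "null_le (x \<^bold>\<rightarrow> y) (x' \<^bold>\<rightarrow> y')"
proof (rule null_le_trans)
  show "null_le (x \<^bold>\<rightarrow> y) (x' \<^bold>\<rightarrow> y)" using assms by (intro null_le_imp_anti)
  show "null_le (x' \<^bold>\<rightarrow> y) (x' \<^bold>\<rightarrow> y')" using assms by (intro null_le_imp_mono)
qed (simp_all add: assms)

lemma null_le_simp_cong:
  assumes "x \<in> carrier A" "y \<in> carrier A" "x' \<in> carrier A" "y' \<in> carrier A" "null_le x' x" "null_le y y'"
  shows "null_le (x \<leadsto> y) (x' \<leadsto> y')"
proof -
  interpret d: measured_pbck "pbck_dual A" m by (rule dual_measured)
  have "d.null_le a b \<longleftrightarrow> null_le a b" if "a \<in> carrier A" "b \<in> carrier A" for a b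
    using that by (simp add: null_le_def d.null_le_def imp_null_iff_simp_null)
  then show ?thesis using d.null_le_imp_cong[of x y x' y'] assms by simp
qed

abbreviation "E \<equiv> Theta A (Ker0 A m)"
abbreviation "Q \<equiv> pbck_quot A (Ker0 A m)"
abbreviation cls :: "'a \<Rightarrow> 'a set" where "cls x \<equiv> E `` {x}"

lemma E_iff: "(x, y) \<in> E \<longleftrightarrow> x \<in> carrier A \<and> y \<in> carrier A \<and> null_le x y \<and> null_le y x"
  unfolding Theta_def Ker0_def null_le_def using imp_closed by auto

lemma equiv_E: "equiv (carrier A) E"
proof (intro equivI refl_onI symI transI)
  fix x assume "x \<in> carrier A" then show "(x, x) \<in> E"
    unfolding E_iff using le_null_le refl by blast
qed (use null_le_trans in \<open>auto simp: E_iff; blast\<close>)+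

lemma cls_eq_iff: "x \<in> carrier A \<Longrightarrow> y \<in> carrier A \<Longrightarrow> cls x = cls y \<longleftrightarrow> null_le x y \<and> null_le y x"
  using eq_equiv_class_iff[OF equiv_E] E_iff by simp

lemma quot_carrier: "carrier Q = cls ` carrier A"
  unfolding pbck_quot_def Let_def quotient_def by auto

lemma quot_top: "\<^bold>1\<^bsub>Q\<^esub> = cls \<^bold>1"
  unfolding pbck_quot_def Let_def by simp

text \<open>\<open>pbck_quot\<close> takes unions over all representatives. As \<open>f\<close> is
  antitone in its first and monotone in its second argument with respect to \<open>null_le\<close>,
  the family is constant and the union is a single class.\<close>

lemma quot_op:
  assumes "x \<in> carrier A" "y \<in> carrier A"
    and "\<And>u v. u \<in> carrier A \<Longrightarrow> v \<in> carrier A \<Longrightarrow> f u v \<in> carrier A"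
    and "\<And>u v u' v'. \<lbrakk>u \<in> carrier A; v \<in> carrier A; u' \<in> carrier A; v' \<in> carrier A;
      null_le u' u; null_le v v'\<rbrakk> \<Longrightarrow> null_le (f u v) (f u' v')"
  shows "(\<Union>u\<in>cls x. \<Union>v\<in>cls y. cls (f u v)) = cls (f x y)"
proof -
  have "cls (f u v) = cls (f x y)" if "u \<in> cls x" "v \<in> cls y" for u v
    using that assms by (simp add: cls_eq_iff E_iff)
  moreover have "x \<in> cls x" "y \<in> cls y" using assms equiv_class_self[OF equiv_E] by auto
  ultimately show ?thesis by blast
qed

lemma quot_imp: "x \<in> carrier A \<Longrightarrow> y \<in> carrier A \<Longrightarrow> cls x \<^bold>\<rightarrow>\<^bsub>Q\<^esub> cls y = cls (x \<^bold>\<rightarrow> y)"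
  using quot_op[of x y "pimp A"] imp_closed null_le_imp_cong unfolding pbck_quot_def Let_def by simp

lemma quot_simp: "x \<in> carrier A \<Longrightarrow> y \<in> carrier A \<Longrightarrow> cls x \<leadsto>\<^bsub>Q\<^esub> cls y = cls (x \<leadsto> y)"
  using quot_op[of x y "psimp A"] simp_closed null_le_simp_cong unfolding pbck_quot_def Let_def by simp

lemma cls_eq_top: "x \<in> carrier A \<Longrightarrow> cls x = cls \<^bold>1 \<longleftrightarrow> m x = 0"
  using cls_eq_iff[of x "\<^bold>1"] top_closed le_null_le[of x "\<^bold>1"] le_top top_imp by (auto simp: null_le_def)

lemma quot_le: "x \<in> carrier A \<Longrightarrow> y \<in> carrier A \<Longrightarrow> cls x \<preceq>\<^bsub>Q\<^esub> cls y \<longleftrightarrow> null_le x y"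
proof -
  assume *: "x \<in> carrier A" "y \<in> carrier A"
  have "cls x \<preceq>\<^bsub>Q\<^esub> cls y \<longleftrightarrow> cls x \<^bold>\<rightarrow>\<^bsub>Q\<^esub> cls y = cls \<^bold>1"
    unfolding pbck_quot_def Let_def by simp
  then show ?thesis using * quot_imp cls_eq_top imp_closed null_le_def by simp
qed

lemma quot_pseudo_bck: "pseudo_bck Q"
proof (unfold_locales, unfold quot_carrier quot_top)
qed ((elim imageE)?; hypsubst?;
  (simp add: quot_imp quot_simp quot_le cls_eq_iff le_null_le imp_trans simp_trans imp_simp simp_imp refl le_top; fail
  | simp add: quot_imp quot_simp quot_le cls_eq_iff null_le_def imp_top top_imp measure_top
      imp_null_iff_simp_null[symmetric]))+

text \<open>The choice of representative is harmless, since \<open>null_le\<close> in both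
  directions forces equal measures.\<close>

definition qm :: "'a set \<Rightarrow> real" where "qm X = m (SOME x. x \<in> X)"

lemma qm_cls: "x \<in> carrier A \<Longrightarrow> qm (cls x) = m x"
proof -
  assume x: "x \<in> carrier A"
  have "(SOME z. z \<in> cls x) \<in> cls x"
    using x equiv_class_self[OF equiv_E] by (metis someI)
  then show ?thesis unfolding qm_def using null_le_measure x by (auto simp: E_iff intro!: order_antisym)
qed

lemma quot_measure: "bck_measure Q qm"
proof -
  have key: "qm (cls x \<^bold>\<rightarrow>\<^bsub>Q\<^esub> cls y) = m y - m x \<and> qm (cls x \<leadsto>\<^bsub>Q\<^esub> cls y) = m y - m x"
    if *: "x \<in> carrier A" "y \<in> carrier A" "cls y \<preceq>\<^bsub>Q\<^esub> cls x" for x y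
  proof -
    from * have n: "null_le y x" using quot_le by simp
    \<comment> \<open>Being smaller in the quotient does not mean being smaller in A.
      \<open>?u\<close> is another representative of the class of x which does lie above y in A, so
      the measure axiom of A applies to it.\<close>
    let ?u = "(y \<^bold>\<rightarrow> x) \<leadsto> x"
    have u: "?u \<in> carrier A" "y \<preceq> ?u" using * imp_closed simp_closed imp_simp by auto
    have mu: "m ?u = m x" using measure_imp'[of y x] * n null_le_def by simp
    have "null_le x ?u" using * u le_null_le le_simp imp_closed simp_closed by simp
    moreover have "null_le ?u x" using imp_simp_imp[of y x] * n null_le_def by simp
    ultimately have c: "cls ?u = cls x" using cls_eq_iff u * by simp
    have "qm (cls ?u \<^bold>\<rightarrow>\<^bsub>Q\<^esub> cls y) = m y - m x"
      using quot_imp[of ?u y] u * qm_cls measure_imp[of ?u y] mu imp_closed by simp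
    moreover have "qm (cls ?u \<leadsto>\<^bsub>Q\<^esub> cls y) = m y - m x"
      using quot_simp[of ?u y] u * qm_cls measure_simp[of ?u y] mu simp_closed by simp
    ultimately show ?thesis
      using c by simp
  qed
  then show ?thesis unfolding bck_measure_def quot_carrier by (auto simp: qm_cls measure_nonneg)
qed

lemma quot_faithful: "X \<in> carrier Q \<Longrightarrow> qm X = 0 \<Longrightarrow> X = \<^bold>1\<^bsub>Q\<^esub>"
  unfolding quot_carrier quot_top by (erule imageE) (simp add: qm_cls cls_eq_top)

lemma quot_directed: "downwards_directed A \<Longrightarrow> downwards_directed Q"
  unfolding downwards_directed_def quot_carrier using quot_le le_null_le by (simp, meson)

end

section \<open>Faithful measures and commutativity\<close>

locale faithful_pbck = measured_pbck +
  assumes faithful: "x \<in> carrier A \<Longrightarrow> m x = 0 \<Longrightarrow> x = \<^bold>1"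
begin

lemma faithful_eq:
  assumes "x \<in> carrier A" "y \<in> carrier A" "y \<preceq> x" "m y = m x" shows "x = y"
proof -
  have "x \<^bold>\<rightarrow> y = \<^bold>1" using assms measure_imp by (intro faithful) simp_all
  then show ?thesis using assms le_iff_imp by (intro antisym) simp_all
qed

text \<open>The double implication lies above x, and both have measure m c - (m c - m x) = m x, so
  faithfulness identifies them.\<close>

lemma imp_simp_cancel:
  assumes "x \<in> carrier A" "c \<in> carrier A" "c \<preceq> x" shows "(x \<^bold>\<rightarrow> c) \<leadsto> c = x"
  using assms imp_simp le_imp by (intro faithful_eq) (simp_all add: measure_simp measure_imp)

lemma simp_imp_cancel:
  assumes "x \<in> carrier A" "c \<in> carrier A" "c \<preceq> x" shows "(x \<leadsto> c) \<^bold>\<rightarrow> c = x"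
  using assms simp_imp le_simp by (intro faithful_eq) (simp_all add: measure_simp measure_imp)

section \<open>Joins and disjointness\<close>

definition jn :: "'a \<Rightarrow> 'a \<Rightarrow> 'a" where "jn x y = (x \<^bold>\<rightarrow> y) \<leadsto> y"

lemma jn_closed [simp]: "x \<in> carrier A \<Longrightarrow> y \<in> carrier A \<Longrightarrow> jn x y \<in> carrier A"
  unfolding jn_def by simp

lemma jn_upper: "x \<in> carrier A \<Longrightarrow> y \<in> carrier A \<Longrightarrow> x \<preceq> jn x y"
  "x \<in> carrier A \<Longrightarrow> y \<in> carrier A \<Longrightarrow> y \<preceq> jn x y"
  unfolding jn_def using imp_simp le_simp by simp_all

text \<open>Double implication into y is monotone, and by \<open>imp_simp_cancel\<close> it fixes
  every z above y.\<close>

lemma jn_least: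
  assumes "x \<in> carrier A" "y \<in> carrier A" "z \<in> carrier A" "x \<preceq> z" "y \<preceq> z"
  shows "jn x y \<preceq> z"
proof -
  have "(x \<^bold>\<rightarrow> y) \<leadsto> y \<preceq> (z \<^bold>\<rightarrow> y) \<leadsto> y"
    using assms by (intro simp_anti imp_anti) simp_all
  then show ?thesis unfolding jn_def using imp_simp_cancel[of z y] assms by simp
qed

lemma jn_eq_simp_imp:
  assumes "x \<in> carrier A" "y \<in> carrier A" shows "jn x y = (x \<leadsto> y) \<^bold>\<rightarrow> y"
proof (rule antisym)
  show "jn x y \<preceq> (x \<leadsto> y) \<^bold>\<rightarrow> y" using assms simp_imp le_imp by (intro jn_least) simp_all
  have "(x \<leadsto> y) \<^bold>\<rightarrow> y \<preceq> (jn x y \<leadsto> y) \<^bold>\<rightarrow> y"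
    using assms jn_upper by (intro simp_anti imp_anti) simp_all
  then show "(x \<leadsto> y) \<^bold>\<rightarrow> y \<preceq> jn x y" using simp_imp_cancel[of "jn x y" y] jn_upper assms by simp
qed (use assms in simp_all)

lemma jn_comm: "x \<in> carrier A \<Longrightarrow> y \<in> carrier A \<Longrightarrow> jn x y = jn y x"
  using jn_upper jn_least by (intro antisym) simp_all

lemma jn_imp: "x \<in> carrier A \<Longrightarrow> y \<in> carrier A \<Longrightarrow> jn x y \<^bold>\<rightarrow> y = x \<^bold>\<rightarrow> y"
  unfolding jn_def by (rule imp_simp_imp)

lemma jn_simp: "x \<in> carrier A \<Longrightarrow> y \<in> carrier A \<Longrightarrow> jn x y \<leadsto> y = x \<leadsto> y"
  using jn_eq_simp_imp pseudo_bck.imp_simp_imp[OF pseudo_bck_dual, OF pseudo_bck_axioms] by simp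

lemma measure_imp_jn: "x \<in> carrier A \<Longrightarrow> y \<in> carrier A \<Longrightarrow> m (x \<^bold>\<rightarrow> y) = m y - m (jn x y)"
  unfolding jn_def by (rule measure_imp')

lemma dual_faithful: "faithful_pbck (pbck_dual A) m"
  using faithful by (simp add: faithful_pbck_def faithful_pbck_axioms_def dual_measured)

lemma dual_jn: "x \<in> carrier A \<Longrightarrow> y \<in> carrier A \<Longrightarrow> faithful_pbck.jn (pbck_dual A) x y = jn x y"
  by (simp add: faithful_pbck.jn_def[OF dual_faithful] jn_eq_simp_imp)

lemma imp_eq_self:
  assumes "x \<in> carrier A" "y \<in> carrier A" "jn x y = \<^bold>1" shows "x \<^bold>\<rightarrow> y = y"
  using jn_imp[of x y] assms top_imp by simp

text \<open>Disjointness passes to elements closer to 1.\<close>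

lemma jn_top_mono:
  assumes "x \<in> carrier A" "y \<in> carrier A" "z \<in> carrier A" "jn x y = \<^bold>1" "x \<preceq> z" shows "jn z y = \<^bold>1"
proof -
  have "jn x y \<preceq> jn z y"
    using assms jn_upper trans[of x z "jn z y"] by (intro jn_least) simp_all
  then show ?thesis using assms top_le[of "jn z y"] by simp
qed

section \<open>The part of the measure supported by an element\<close>

abbreviation iter :: "'a \<Rightarrow> nat \<Rightarrow> 'a \<Rightarrow> 'a" where "iter p n \<equiv> pimp A p ^^ n"

lemma iter_closed [simp]: "p \<in> carrier A \<Longrightarrow> x \<in> carrier A \<Longrightarrow> iter p n x \<in> carrier A"
  by (induction n) simp_all

lemma iter_mono:
  assumes "p \<in> carrier A" "x \<in> carrier A" "y \<in> carrier A" "x \<preceq> y" shows "iter p n x \<preceq> iter p n y"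
  using assms by (induction n) (simp_all add: imp_mono)

lemma le_iter: "p \<in> carrier A \<Longrightarrow> x \<in> carrier A \<Longrightarrow> x \<preceq> iter p n x"
proof (induction n)
  case (Suc n)
  then show ?case using trans[of x "iter p n x" "iter p (Suc n) x"] le_imp by simp
qed (simp add: refl)

lemma measure_iter_step:
  "p \<in> carrier A \<Longrightarrow> x \<in> carrier A \<Longrightarrow> m (jn p (iter p n x)) = m (iter p n x) - m (iter p (Suc n) x)"
  by (simp add: measure_imp_jn)

text \<open>Step n loses exactly the measure of \<open>jn p (iter p n x)\<close>. This element lies
  above \<open>jn p x\<close>, so no step loses more than the first.\<close>

lemma iter_bound:
  assumes "p \<in> carrier A" "x \<in> carrier A"
  shows "m x - real n * m (jn p x) \<le> m (iter p n x)"
proof (induction n)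
  case (Suc n)
  have "jn p x \<preceq> jn p (iter p n x)"
    using assms jn_upper le_iter trans[of x "iter p n x" "jn p (iter p n x)"] by (intro jn_least) simp_all
  then have "m (jn p (iter p n x)) \<le> m (jn p x)" using assms by (simp add: measure_anti)
  then show ?case using Suc assms measure_iter_step[of p x n] by (simp add: algebra_simps)
qed simp

definition off :: "'a \<Rightarrow> 'a \<Rightarrow> real" where "off p x = lim (\<lambda>n. m (iter p n x))"

lemma off_lim:
  assumes "p \<in> carrier A" "x \<in> carrier A" shows "(\<lambda>n. m (iter p n x)) \<longlonglongrightarrow> off p x"
proof -
  have "decseq (\<lambda>n. m (iter p n x))"
    using assms measure_anti le_imp by (intro decseq_SucI) simp
  moreover have "\<forall>n. 0 \<le> m (iter p n x)" using measure_nonneg assms by simp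
  ultimately obtain l where "(\<lambda>n. m (iter p n x)) \<longlonglongrightarrow> l" by (rule decseq_convergent)
  then show ?thesis unfolding off_def by (simp add: limI)
qed

lemma iter_jn_lim:
  assumes "p \<in> carrier A" "x \<in> carrier A" shows "(\<lambda>n. m (jn p (iter p n x))) \<longlonglongrightarrow> 0"
proof -
  have "(\<lambda>n. m (iter p n x) - m (iter p (Suc n) x)) \<longlonglongrightarrow> off p x - off p x"
    by (intro tendsto_diff LIMSEQ_Suc off_lim assms)
  then show ?thesis using measure_iter_step assms by simp
qed

text \<open>\<open>off p x\<close> is the largest limit of measures of parts of \<open>x\<close> that become disjoint from \<open>p\<close>.\<close>

lemma off_greatest:
  assumes p: "p \<in> carrier A" and x: "x \<in> carrier A" and v: "\<And>k. v k \<in> carrier A" "\<And>k. x \<preceq> v k"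
    and lim: "(\<lambda>k. m (v k)) \<longlonglongrightarrow> l" "(\<lambda>k. m (jn p (v k))) \<longlonglongrightarrow> 0"
  shows "l \<le> off p x"
proof (rule LIMSEQ_le_const[OF off_lim[OF p x]], intro exI allI impI)
  fix n
  have "m (v k) - real n * m (jn p (v k)) \<le> m (iter p n x)" for k
  proof -
    have "m (iter p n (v k)) \<le> m (iter p n x)"
      using p x v by (intro measure_anti iter_mono) simp_all
    then show ?thesis using iter_bound[OF p v(1), of k n] by linarith
  qed
  \<comment> \<open>Here n stays fixed while k tends to infinity: the loss over n steps vanishes in
    the limit.\<close>
  moreover have "(\<lambda>k. m (v k) - real n * m (jn p (v k))) \<longlonglongrightarrow> l - real n * 0"
    by (intro tendsto_intros lim)
  ultimately show "l \<le> m (iter p n x)" by (intro LIMSEQ_le_const2[of _ l]) auto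
qed

text \<open>The hypotheses of \<open>off_greatest\<close> involve only m, the order and joins, all
  shared with the dual. So the iterates of p \<rightarrow> compete for the limit that belongs to p
  \<leadsto>.\<close>

lemma off_dual_le:
  assumes "p \<in> carrier A" "x \<in> carrier A"
  shows "off p x \<le> faithful_pbck.off (pbck_dual A) m p x"
proof -
  interpret d: faithful_pbck "pbck_dual A" m by (rule dual_faithful)
  show ?thesis
    using assms off_lim iter_jn_lim le_iter dual_jn
    by (intro d.off_greatest[of p x "\<lambda>k. iter p k x"]) simp_all
qed

lemma off_dual:
  assumes "p \<in> carrier A" "x \<in> carrier A"
  shows "faithful_pbck.off (pbck_dual A) m p x = off p x"
proof -
  have dual_dual: "pbck_dual (pbck_dual A) = A" by (simp add: pbck_dual_def)
  show ?thesis
    using off_dual_le[OF assms] faithful_pbck.off_dual_le[OF dual_faithful, of p x, unfolded dual_dual] assms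
    by simp
qed

lemma simp_iter:
  "p \<in> carrier A \<Longrightarrow> x \<in> carrier A \<Longrightarrow> a \<in> carrier A \<Longrightarrow> a \<leadsto> iter p n x = iter p n (a \<leadsto> x)"
  by (induction n) (simp_all add: exchange[symmetric])

text \<open>By cancellation x = u \<leadsto> y with u = x \<rightarrow> y. The operation u
  \<leadsto> passes through the iterates by \<open>exchange\<close>, so the left side is (u
  \<leadsto> w) \<rightarrow> w with w = \<open>iter p n y\<close>, which is a join.\<close>

lemma iter_imp_iter:
  assumes "p \<in> carrier A" "x \<in> carrier A" "y \<in> carrier A" "y \<preceq> x"
  shows "iter p n x \<^bold>\<rightarrow> iter p n y = jn (x \<^bold>\<rightarrow> y) (iter p n y)"
  using assms by (simp add: jn_eq_simp_imp simp_iter imp_simp_cancel)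

lemma off_imp:
  assumes "p \<in> carrier A" "x \<in> carrier A" "y \<in> carrier A" "y \<preceq> x"
  shows "off p (x \<^bold>\<rightarrow> y) = off p y - off p x"
proof (rule order_antisym)
  \<comment> \<open>By \<open>iter_imp_iter\<close>, \<open>?v k\<close> is the implication between
    the k-th iterates of x and y. It competes in \<open>off_greatest\<close> for \<open>?u\<close>,
    which gives one inequality, and it lies below \<open>iter p k ?u\<close>, which gives the
    other.\<close>
  let ?u = "x \<^bold>\<rightarrow> y" and ?v = "\<lambda>k. jn (x \<^bold>\<rightarrow> y) (iter p k y)"
  have mv: "m (?v k) = m (iter p k y) - m (iter p k x)" for k
    using assms measure_imp[of "iter p k x" "iter p k y"] iter_mono iter_imp_iter by simp
  have lim: "(\<lambda>k. m (?v k)) \<longlonglongrightarrow> off p y - off p x"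
    unfolding mv by (intro tendsto_diff off_lim assms)
  have v_le: "m (jn p (?v k)) \<le> m (jn p (iter p k y))" for k
  proof -
    have "jn p (iter p k y) \<preceq> jn p (?v k)"
      using assms jn_upper trans[of "iter p k y" "?v k" "jn p (?v k)"] by (intro jn_least) simp_all
    then show ?thesis using assms by (simp add: measure_anti)
  qed
  have "(\<lambda>k. m (jn p (?v k))) \<longlonglongrightarrow> 0"
    by (rule tendsto_sandwich[OF _ _ tendsto_const iter_jn_lim[of p y]])
      (use assms measure_nonneg v_le in simp_all)
  then show "off p y - off p x \<le> off p ?u"
    using assms lim jn_upper by (intro off_greatest[of p ?u ?v]) simp_all
  have "m (iter p k ?u) \<le> m (?v k)" for k
    using assms le_iter iter_mono le_imp by (intro measure_anti jn_least) simp_all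
  then show "off p ?u \<le> off p y - off p x"
    using assms lim off_lim[of p ?u] by (intro LIMSEQ_le[OF _ lim]) auto
qed

lemma off_simp:
  assumes "p \<in> carrier A" "x \<in> carrier A" "y \<in> carrier A" "y \<preceq> x"
  shows "off p (x \<leadsto> y) = off p y - off p x"
  using faithful_pbck.off_imp[OF dual_faithful, of p x y] assms off_dual by simp

definition lam :: "'a \<Rightarrow> 'a \<Rightarrow> real" where "lam p x = m x - off p x"

lemma lam_imp:
  assumes "p \<in> carrier A" "x \<in> carrier A" "y \<in> carrier A" "y \<preceq> x"
  shows "lam p (x \<^bold>\<rightarrow> y) = lam p y - lam p x"
  using assms off_imp measure_imp unfolding lam_def by simp

lemma lam_simp:
  assumes "p \<in> carrier A" "x \<in> carrier A" "y \<in> carrier A" "y \<preceq> x"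
  shows "lam p (x \<leadsto> y) = lam p y - lam p x"
  using assms off_simp measure_simp unfolding lam_def by simp

lemma lam_nonneg: "p \<in> carrier A \<Longrightarrow> x \<in> carrier A \<Longrightarrow> 0 \<le> lam p x"
  unfolding lam_def
  using LIMSEQ_le_const2[OF off_lim, of p x "m x"] measure_anti le_iter by auto

lemma lam_disjoint:
  assumes "p \<in> carrier A" "x \<in> carrier A" "jn p x = \<^bold>1" shows "lam p x = 0"
proof -
  have "iter p n x = x" for n using assms imp_eq_self by (induction n) simp_all
  then show ?thesis unfolding lam_def off_def by simp
qed

lemma lam_self:
  assumes "p \<in> carrier A" shows "lam p p = m p"
proof -
  \<comment> \<open>The zeroth iterate is p itself; only from p \<rightarrow> p onwards is the
    sequence constantly 1.\<close>
  have "iter p (Suc n) p = \<^bold>1" for n using assms imp_refl imp_top by (induction n) simp_all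
  then have "(\<lambda>n. m (iter p (Suc n) p)) \<longlonglongrightarrow> 0" using measure_top by simp
  then have "(\<lambda>n. m (iter p n p)) \<longlonglongrightarrow> 0" by (rule LIMSEQ_imp_Suc)
  then show ?thesis unfolding lam_def using off_lim[OF assms assms] LIMSEQ_unique by force
qed

end

section \<open>Prelinearity, separation and commutativity\<close>

locale directed_pbck = faithful_pbck +
  assumes directed: "downwards_directed A"
begin

lemma prelinear:
  assumes x: "x \<in> carrier A" and y: "y \<in> carrier A" shows "jn (y \<^bold>\<rightarrow> x) (x \<^bold>\<rightarrow> y) = \<^bold>1"
proof -
  obtain c where c: "c \<in> carrier A" "c \<preceq> x" "c \<preceq> y"
    using directed x y unfolding downwards_directed_def by blast
  \<comment> \<open>the meet of \<open>x\<close> and \<open>y\<close>, by De Morgan in the interval above \<open>c\<close>\<close>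
  define k where "k = jn (x \<^bold>\<rightarrow> c) (y \<^bold>\<rightarrow> c) \<leadsto> c"
  have k: "k \<in> carrier A" unfolding k_def using x y c by simp
  \<comment> \<open>Stated for u and v so as to serve both orders of x and y.
    \<open>exchange\<close> brings u next to c, \<open>jn_simp\<close> drops u \<rightarrow> c from
    the join, and \<open>exchange\<close> with cancellation leaves u \<rightarrow> v.\<close>
  have meet: "u \<^bold>\<rightarrow> (jn (x \<^bold>\<rightarrow> c) (y \<^bold>\<rightarrow> c) \<leadsto> c) = u \<^bold>\<rightarrow> v"
    if "u \<in> carrier A" "v \<in> carrier A" "c \<preceq> v" "jn (x \<^bold>\<rightarrow> c) (y \<^bold>\<rightarrow> c) = jn (v \<^bold>\<rightarrow> c) (u \<^bold>\<rightarrow> c)" for u v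
  proof -
    have "u \<^bold>\<rightarrow> (jn (x \<^bold>\<rightarrow> c) (y \<^bold>\<rightarrow> c) \<leadsto> c) = jn (v \<^bold>\<rightarrow> c) (u \<^bold>\<rightarrow> c) \<leadsto> (u \<^bold>\<rightarrow> c)"
      using that x y c exchange[of u "jn (x \<^bold>\<rightarrow> c) (y \<^bold>\<rightarrow> c)" c] by simp
    also have "\<dots> = u \<^bold>\<rightarrow> ((v \<^bold>\<rightarrow> c) \<leadsto> c)"
      using that c jn_simp[of "v \<^bold>\<rightarrow> c" "u \<^bold>\<rightarrow> c"] exchange[of u "v \<^bold>\<rightarrow> c" c] by simp
    finally show ?thesis using that c imp_simp_cancel by simp
  qed
  have xk: "x \<^bold>\<rightarrow> k = x \<^bold>\<rightarrow> y" unfolding k_def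
    by (rule meet) (use x y c jn_comm in simp_all)
  have yk: "y \<^bold>\<rightarrow> k = y \<^bold>\<rightarrow> x" unfolding k_def
    by (rule meet) (use x y c in simp_all)
  have "k \<preceq> (y \<^bold>\<rightarrow> c) \<leadsto> c" unfolding k_def using x y c jn_upper by (intro simp_anti) simp_all
  then have ky: "k \<preceq> y" using y c imp_simp_cancel by simp
  \<comment> \<open>Both implications may be taken into the common lower bound k, where (y
    \<rightarrow> k) \<leadsto> k cancels to y.\<close>
  have "(y \<^bold>\<rightarrow> x) \<leadsto> (x \<^bold>\<rightarrow> y) = x \<^bold>\<rightarrow> ((y \<^bold>\<rightarrow> k) \<leadsto> k)"
    using xk yk x y k exchange[of x "y \<^bold>\<rightarrow> k" k] by simp
  then have "(y \<^bold>\<rightarrow> x) \<leadsto> (x \<^bold>\<rightarrow> y) = x \<^bold>\<rightarrow> y"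
    using ky y k imp_simp_cancel by simp
  then show ?thesis using jn_eq_simp_imp x y imp_refl by simp
qed

text \<open>Both implications may be taken from the common join of x and y, whose value
  cancels.\<close>

lemma lam_diff:
  assumes "p \<in> carrier A" "x \<in> carrier A" "y \<in> carrier A"
  shows "lam p (x \<^bold>\<rightarrow> y) - lam p (y \<^bold>\<rightarrow> x) = lam p y - lam p x"
  using lam_imp[of p "jn x y" y] lam_imp[of p "jn y x" x] jn_comm[of y x] jn_imp[of x y] jn_imp[of y x]
    jn_upper assms by simp

text \<open>The positive and negative part of the difference of \<open>x\<close> and \<open>y\<close> are disjoint, so the values
  \<open>lam p x\<close> determine \<open>x\<close>.\<close>

lemma le_if_lam_ge:
  assumes xy: "x \<in> carrier A" "y \<in> carrier A" and le: "\<And>p. p \<in> carrier A \<Longrightarrow> lam p y \<le> lam p x"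
  shows "x \<preceq> y"
proof -
  let ?p = "x \<^bold>\<rightarrow> y"
  have "lam ?p (y \<^bold>\<rightarrow> x) = 0" using xy prelinear jn_comm by (intro lam_disjoint) simp_all
  then have "m ?p \<le> 0" using lam_diff[of ?p x y] le[of ?p] lam_self[of ?p] xy by simp
  then have "?p = \<^bold>1" using xy measure_nonneg[of ?p] by (intro faithful) simp_all
  then show ?thesis using xy le_iff_imp by simp
qed

text \<open>In the group to be constructed, \<open>(x \<leadsto> y) \<leadsto> y\<close> is the conjugate of \<open>x\<close> by \<open>y\<close>. Every
  \<open>lam p\<close> is invariant under this conjugation, hence the conjugation is trivial.\<close>

lemma imp_eq_simp:
  assumes xy: "x \<in> carrier A" "y \<in> carrier A" shows "x \<^bold>\<rightarrow> y = x \<leadsto> y"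
proof -
  have conj: "(z \<leadsto> y) \<leadsto> y = z" if z: "z \<in> carrier A" "y \<preceq> z" for z
  proof (rule antisym)
    have "lam p ((z \<leadsto> y) \<leadsto> y) = lam p z" if "p \<in> carrier A" for p
      using lam_simp[of p "z \<leadsto> y" y] lam_simp[of p z y] that z xy le_simp by simp
    then show "(z \<leadsto> y) \<leadsto> y \<preceq> z" "z \<preceq> (z \<leadsto> y) \<leadsto> y"
      using z xy by (auto intro: le_if_lam_ge)
  qed (use z xy in simp_all)
  let ?z = "jn x y"
  have z: "?z \<in> carrier A" "y \<preceq> ?z" using xy jn_upper by simp_all
  have "?z \<^bold>\<rightarrow> y = ((?z \<leadsto> y) \<leadsto> y) \<^bold>\<rightarrow> y" using conj z by simp
  also have "\<dots> = ?z \<leadsto> y" using z xy le_simp by (intro simp_imp_cancel) simp_all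
  finally show ?thesis using jn_imp jn_simp xy by simp
qed

end

section \<open>Lattice-ordered groups\<close>

lemma ord_of_simps [simp]: "carrier (ord_of G) = carrier G" "le (ord_of G) = ogle G" "eq (ord_of G) = (=)"
  by (simp_all add: ord_of_def)

context l_group
begin

sublocale ord: lattice "ord_of G"
  by (rule lattice_order)

lemma le_refl': "g \<in> carrier G \<Longrightarrow> g \<unlhd> g"
  using ord.le_refl by simp

lemma le_antisym': "g \<in> carrier G \<Longrightarrow> h \<in> carrier G \<Longrightarrow> g \<unlhd> h \<Longrightarrow> h \<unlhd> g \<Longrightarrow> g = h"
  using ord.le_antisym by simp

lemma le_trans': "g \<in> carrier G \<Longrightarrow> h \<in> carrier G \<Longrightarrow> k \<in> carrier G \<Longrightarrow> g \<unlhd> h \<Longrightarrow> h \<unlhd> k \<Longrightarrow> g \<unlhd> k"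
  using ord.le_trans by simp

lemma meet_closed' [simp]: "g \<in> carrier G \<Longrightarrow> h \<in> carrier G \<Longrightarrow> g \<sqinter>\<^bsub>ord_of G\<^esub> h \<in> carrier G"
  using ord.meet_closed by simp

lemma join_closed' [simp]: "g \<in> carrier G \<Longrightarrow> h \<in> carrier G \<Longrightarrow> g \<squnion>\<^bsub>ord_of G\<^esub> h \<in> carrier G"
  using ord.join_closed by simp

lemma meet_lower:
  assumes "g \<in> carrier G" "h \<in> carrier G"
  shows "g \<sqinter>\<^bsub>ord_of G\<^esub> h \<unlhd> g" "g \<sqinter>\<^bsub>ord_of G\<^esub> h \<unlhd> h"
  using ord.meet_left[of g h] ord.meet_right[of g h] assms by simp_all

lemma join_upper:
  assumes "g \<in> carrier G" "h \<in> carrier G"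
  shows "g \<unlhd> g \<squnion>\<^bsub>ord_of G\<^esub> h" "h \<unlhd> g \<squnion>\<^bsub>ord_of G\<^esub> h"
  using ord.join_left[of g h] ord.join_right[of g h] assms by simp_all

lemma meet_greatest:
  "\<lbrakk>g \<in> carrier G; h \<in> carrier G; k \<in> carrier G; k \<unlhd> g; k \<unlhd> h\<rbrakk> \<Longrightarrow> k \<unlhd> g \<sqinter>\<^bsub>ord_of G\<^esub> h"
  using ord.meet_le[of k g h] by simp

lemma join_least:
  "\<lbrakk>g \<in> carrier G; h \<in> carrier G; k \<in> carrier G; g \<unlhd> k; h \<unlhd> k\<rbrakk> \<Longrightarrow> g \<squnion>\<^bsub>ord_of G\<^esub> h \<unlhd> k"
  using ord.join_le[of g k h] by simp

lemma meet_eqI: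
  assumes "g \<in> carrier G" "h \<in> carrier G" "k \<in> carrier G" "k \<unlhd> g" "k \<unlhd> h"
    and "\<And>l. l \<in> carrier G \<Longrightarrow> l \<unlhd> g \<Longrightarrow> l \<unlhd> h \<Longrightarrow> l \<unlhd> k"
  shows "g \<sqinter>\<^bsub>ord_of G\<^esub> h = k"
  using assms meet_lower meet_greatest by (intro le_antisym') simp_all

lemma join_eqI:
  assumes "g \<in> carrier G" "h \<in> carrier G" "k \<in> carrier G" "g \<unlhd> k" "h \<unlhd> k"
    and "\<And>l. l \<in> carrier G \<Longrightarrow> g \<unlhd> l \<Longrightarrow> h \<unlhd> l \<Longrightarrow> k \<unlhd> l"
  shows "g \<squnion>\<^bsub>ord_of G\<^esub> h = k"
  using assms join_upper join_least by (intro le_antisym') simp_all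

lemma mult_right_mono: "\<lbrakk>g \<in> carrier G; h \<in> carrier G; a \<in> carrier G; g \<unlhd> h\<rbrakk> \<Longrightarrow> g \<otimes> a \<unlhd> h \<otimes> a"
  using mult_mono[of g h \<one> a] by simp

lemma mult_left_mono: "\<lbrakk>g \<in> carrier G; h \<in> carrier G; a \<in> carrier G; g \<unlhd> h\<rbrakk> \<Longrightarrow> a \<otimes> g \<unlhd> a \<otimes> h"
  using mult_mono[of g h a \<one>] by simp

lemma mult_right_le_iff: "\<lbrakk>g \<in> carrier G; h \<in> carrier G; a \<in> carrier G\<rbrakk> \<Longrightarrow> g \<otimes> a \<unlhd> h \<otimes> a \<longleftrightarrow> g \<unlhd> h"
  using mult_right_mono[of g h a] mult_right_mono[of "g \<otimes> a" "h \<otimes> a" "inv a"] by (auto simp: m_assoc)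

lemma mult_left_le_iff: "\<lbrakk>g \<in> carrier G; h \<in> carrier G; a \<in> carrier G\<rbrakk> \<Longrightarrow> a \<otimes> g \<unlhd> a \<otimes> h \<longleftrightarrow> g \<unlhd> h"
  using mult_left_mono[of g h a] mult_left_mono[of "a \<otimes> g" "a \<otimes> h" "inv a"] by (auto simp: m_assoc[symmetric])

lemma inv_le_iff:
  assumes "g \<in> carrier G" "h \<in> carrier G" shows "inv g \<unlhd> inv h \<longleftrightarrow> h \<unlhd> g"
  using mult_right_le_iff[of "inv g" "inv h" h] mult_left_le_iff[of "inv g \<otimes> h" "\<one>" g] assms
  by (simp add: m_assoc[symmetric])

lemma meet_mult_right:
  assumes "g \<in> carrier G" "h \<in> carrier G" "a \<in> carrier G"
  shows "(g \<otimes> a) \<sqinter>\<^bsub>ord_of G\<^esub> (h \<otimes> a) = (g \<sqinter>\<^bsub>ord_of G\<^esub> h) \<otimes> a"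
proof (rule meet_eqI)
  fix l assume l: "l \<in> carrier G" "l \<unlhd> g \<otimes> a" "l \<unlhd> h \<otimes> a"
  have "l \<otimes> inv a \<unlhd> g \<sqinter>\<^bsub>ord_of G\<^esub> h"
    using l assms mult_right_mono[of l "g \<otimes> a" "inv a"] mult_right_mono[of l "h \<otimes> a" "inv a"]
    by (intro meet_greatest) (simp_all add: m_assoc)
  then show "l \<unlhd> (g \<sqinter>\<^bsub>ord_of G\<^esub> h) \<otimes> a"
    using l assms mult_right_mono[of "l \<otimes> inv a" "g \<sqinter>\<^bsub>ord_of G\<^esub> h" a] by (simp add: m_assoc)
qed (use assms meet_lower mult_right_mono in simp_all)

lemma meet_mult_left:
  assumes "g \<in> carrier G" "h \<in> carrier G" "a \<in> carrier G"
  shows "(a \<otimes> g) \<sqinter>\<^bsub>ord_of G\<^esub> (a \<otimes> h) = a \<otimes> (g \<sqinter>\<^bsub>ord_of G\<^esub> h)"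
proof (rule meet_eqI)
  fix l assume l: "l \<in> carrier G" "l \<unlhd> a \<otimes> g" "l \<unlhd> a \<otimes> h"
  have "inv a \<otimes> l \<unlhd> g \<sqinter>\<^bsub>ord_of G\<^esub> h"
    using l assms mult_left_mono[of l "a \<otimes> g" "inv a"] mult_left_mono[of l "a \<otimes> h" "inv a"]
    by (intro meet_greatest) (simp_all add: m_assoc[symmetric])
  then show "l \<unlhd> a \<otimes> (g \<sqinter>\<^bsub>ord_of G\<^esub> h)"
    using l assms mult_left_mono[of "inv a \<otimes> l" "g \<sqinter>\<^bsub>ord_of G\<^esub> h" a] by (simp add: m_assoc[symmetric])
qed (use assms meet_lower mult_left_mono in simp_all)

lemma join_eq_inv_meet:
  assumes "g \<in> carrier G" "h \<in> carrier G"
  shows "g \<squnion>\<^bsub>ord_of G\<^esub> h = inv (inv g \<sqinter>\<^bsub>ord_of G\<^esub> inv h)"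
proof (rule join_eqI)
  fix l assume l: "l \<in> carrier G" "g \<unlhd> l" "h \<unlhd> l"
  then have "inv l \<unlhd> inv g \<sqinter>\<^bsub>ord_of G\<^esub> inv h" using assms by (intro meet_greatest) (simp_all add: inv_le_iff)
  then show "inv (inv g \<sqinter>\<^bsub>ord_of G\<^esub> inv h) \<unlhd> l"
    using l assms inv_le_iff[of "inv l" "inv g \<sqinter>\<^bsub>ord_of G\<^esub> inv h"] inv_le_iff[of "inv g \<sqinter>\<^bsub>ord_of G\<^esub> inv h" "inv l"] by simp
qed (use assms meet_lower[of "inv g" "inv h"] inv_le_iff[of "inv g" "inv g \<sqinter>\<^bsub>ord_of G\<^esub> inv h"]
  inv_le_iff[of "inv h" "inv g \<sqinter>\<^bsub>ord_of G\<^esub> inv h"] inv_le_iff[of "inv (inv g \<sqinter>\<^bsub>ord_of G\<^esub> inv h)" "inv g"]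
  inv_le_iff[of "inv (inv g \<sqinter>\<^bsub>ord_of G\<^esub> inv h)" "inv h"] in \<open>simp_all\<close>)

text \<open>Together with \<open>join_eq_inv_meet\<close> this reduces all lattice operations to the
  meet with \<one>, the one that occurs in \<open>neg_cone\<close> and that the rewriting of lists
  computes.\<close>

lemma meet_eq_meet_one:
  assumes "g \<in> carrier G" "h \<in> carrier G"
  shows "g \<sqinter>\<^bsub>ord_of G\<^esub> h = ((g \<otimes> inv h) \<sqinter>\<^bsub>ord_of G\<^esub> \<one>) \<otimes> h"
  using meet_mult_right[of "g \<otimes> inv h" \<one> h] assms by (simp add: m_assoc)

lemma l_subgroup_carrier: "l_subgroup (carrier G) G"
  unfolding l_subgroup_def using subgroup_self by simp

lemma l_generates_iff:
  assumes "S \<subseteq> carrier G"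
  shows "l_generates S G \<longleftrightarrow> (\<forall>H. l_subgroup H G \<longrightarrow> S \<subseteq> H \<longrightarrow> H = carrier G)"
proof -
  have "\<Inter>{H. l_subgroup H G \<and> S \<subseteq> H} \<subseteq> carrier G" using l_subgroup_carrier assms by blast
  moreover have "H \<subseteq> carrier G" if "l_subgroup H G" for H
    using that subgroup.subset unfolding l_subgroup_def by blast
  ultimately show ?thesis unfolding l_generates_def by blast
qed

lemma l_subgroupI:
  assumes "subgroup H G" and "\<And>g. g \<in> H \<Longrightarrow> g \<sqinter>\<^bsub>ord_of G\<^esub> \<one> \<in> H"
  shows "l_subgroup H G"
proof -
  have sub: "H \<subseteq> carrier G" using assms(1) by (rule subgroup.subset)
  have meet: "g \<sqinter>\<^bsub>ord_of G\<^esub> h \<in> H" if "g \<in> H" "h \<in> H" for g h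
    using that sub assms(2)[of "g \<otimes> inv h"] meet_eq_meet_one[of g h]
      subgroup.m_closed[OF assms(1)] subgroup.m_inv_closed[OF assms(1)] by (simp add: subset_iff)
  have "g \<squnion>\<^bsub>ord_of G\<^esub> h \<in> H" if "g \<in> H" "h \<in> H" for g h
    using that sub meet join_eq_inv_meet[of g h] subgroup.m_inv_closed[OF assms(1)] by (simp add: subset_iff)
  then show ?thesis unfolding l_subgroup_def using assms(1) meet by blast
qed

text \<open>Left and right translations preserve meets, so s commutes with g \<sqinter> \<one>
  whenever it commutes with g.\<close>

lemma l_subgroup_centralizer:
  assumes "S \<subseteq> carrier G"
  shows "l_subgroup {g \<in> carrier G. \<forall>s\<in>S. s \<otimes> g = g \<otimes> s} G"
proof (rule l_subgroupI)
  show "subgroup {g \<in> carrier G. \<forall>s\<in>S. s \<otimes> g = g \<otimes> s} G"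
  proof (rule subgroupI)
    fix a assume a: "a \<in> {g \<in> carrier G. \<forall>s\<in>S. s \<otimes> g = g \<otimes> s}"
    have "s \<otimes> inv a = inv a \<otimes> s" if "s \<in> S" for s
    proof -
      have s: "s \<in> carrier G" "s \<otimes> a = a \<otimes> s" "a \<in> carrier G" using that a assms by auto
      have "s \<otimes> inv a = inv a \<otimes> (a \<otimes> s) \<otimes> inv a" using s(1,3) by (simp add: m_assoc[symmetric])
      also have "\<dots> = inv a \<otimes> (s \<otimes> a) \<otimes> inv a" using s by simp
      also have "\<dots> = inv a \<otimes> s" using s(1,3) by (simp add: m_assoc)
      finally show ?thesis .
    qed
    then show "inv a \<in> {g \<in> carrier G. \<forall>s\<in>S. s \<otimes> g = g \<otimes> s}" using a by simp
  next
    fix a b assume ab: "a \<in> {g \<in> carrier G. \<forall>s\<in>S. s \<otimes> g = g \<otimes> s}" "b \<in> {g \<in> carrier G. \<forall>s\<in>S. s \<otimes> g = g \<otimes> s}"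
    have "s \<otimes> (a \<otimes> b) = a \<otimes> b \<otimes> s" if "s \<in> S" for s
    proof -
      have s: "s \<in> carrier G" "s \<otimes> a = a \<otimes> s" "s \<otimes> b = b \<otimes> s" "a \<in> carrier G" "b \<in> carrier G"
        using that ab assms by auto
      have "s \<otimes> (a \<otimes> b) = s \<otimes> a \<otimes> b" using s(1,4,5) by (simp add: m_assoc)
      also have "\<dots> = a \<otimes> (s \<otimes> b)" using s(1,4,5) by (simp add: s(2) m_assoc)
      also have "\<dots> = a \<otimes> b \<otimes> s" using s(1,4,5) by (simp add: s(3) m_assoc)
      finally show ?thesis .
    qed
    then show "a \<otimes> b \<in> {g \<in> carrier G. \<forall>s\<in>S. s \<otimes> g = g \<otimes> s}" using ab by simp
  next
    show "{g \<in> carrier G. \<forall>s\<in>S. s \<otimes> g = g \<otimes> s} \<noteq> {}" using assms by (auto intro!: exI[of _ \<one>])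
  qed auto
next
  fix g assume g: "g \<in> {g \<in> carrier G. \<forall>s\<in>S. s \<otimes> g = g \<otimes> s}"
  have "s \<otimes> (g \<sqinter>\<^bsub>ord_of G\<^esub> \<one>) = (g \<sqinter>\<^bsub>ord_of G\<^esub> \<one>) \<otimes> s" if "s \<in> S" for s
    using that g assms meet_mult_left[of g \<one> s] meet_mult_right[of g \<one> s] by auto
  then show "g \<sqinter>\<^bsub>ord_of G\<^esub> \<one> \<in> {g \<in> carrier G. \<forall>s\<in>S. s \<otimes> g = g \<otimes> s}" using g by simp
qed

lemma comm_if_generators_commute:
  assumes S: "S \<subseteq> carrier G" "l_generates S G" and comm: "\<And>s t. s \<in> S \<Longrightarrow> t \<in> S \<Longrightarrow> s \<otimes> t = t \<otimes> s"
  shows "comm_group G"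
proof -
  have gen: "H = carrier G" if "l_subgroup H G" "S \<subseteq> H" for H
    using that S l_generates_iff by blast
  have "{g \<in> carrier G. \<forall>s\<in>S. s \<otimes> g = g \<otimes> s} = carrier G"
    using S comm by (intro gen l_subgroup_centralizer) auto
  \<comment> \<open>By the previous step the generators lie in the centre, which is again a
    centralizer and hence everything.\<close>
  then have "{g \<in> carrier G. \<forall>s\<in>carrier G. s \<otimes> g = g \<otimes> s} = carrier G"
    using S by (intro gen l_subgroup_centralizer) (auto, metis (mono_tags, lifting) CollectD)
  then show ?thesis by (intro group_comm_groupI) auto
qed

text \<open>For elements below \<one>, disjointness is expressed by the meet being the product; this
  extends it from single elements to products.\<close>

lemma disjoint_mult:
  assumes "u \<in> carrier G" "v \<in> carrier G" "w \<in> carrier G" "u \<unlhd> \<one>" "v \<unlhd> \<one>" "w \<unlhd> \<one>"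
    and "u \<sqinter>\<^bsub>ord_of G\<^esub> w = u \<otimes> w" "v \<sqinter>\<^bsub>ord_of G\<^esub> w = v \<otimes> w"
  shows "(u \<otimes> v) \<sqinter>\<^bsub>ord_of G\<^esub> w = u \<otimes> v \<otimes> w"
proof (rule meet_eqI)
  show "u \<otimes> v \<otimes> w \<unlhd> u \<otimes> v"
    using assms mult_left_mono[of w \<one> "u \<otimes> v"] by simp
  have "v \<otimes> w \<unlhd> w" using assms mult_right_mono[of v \<one> w] by simp
  moreover have "u \<otimes> (v \<otimes> w) \<unlhd> v \<otimes> w" using assms mult_right_mono[of u \<one> "v \<otimes> w"] by simp
  ultimately show "u \<otimes> v \<otimes> w \<unlhd> w"
    using assms le_trans'[of "u \<otimes> (v \<otimes> w)" "v \<otimes> w" w] by (simp add: m_assoc)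
  fix l assume l: "l \<in> carrier G" "l \<unlhd> u \<otimes> v" "l \<unlhd> w"
  \<comment> \<open>Disjointness is used one factor at a time: bounds by u and w give a bound by
    their product, from which u is cancelled before v is treated.\<close>
  have "l \<unlhd> u" using l assms mult_left_mono[of v \<one> u] le_trans'[of l "u \<otimes> v" u] by simp
  then have "l \<unlhd> u \<otimes> w" using l assms meet_greatest[of u w l] by simp
  then have "inv u \<otimes> l \<unlhd> w" using l assms mult_left_le_iff[of "inv u \<otimes> l" w u] by (simp add: m_assoc[symmetric])
  moreover have "inv u \<otimes> l \<unlhd> v" using l assms mult_left_le_iff[of "inv u \<otimes> l" v u] by (simp add: m_assoc[symmetric])
  ultimately have "inv u \<otimes> l \<unlhd> v \<otimes> w" using l assms meet_greatest[of v w "inv u \<otimes> l"] by simp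
  then show "l \<unlhd> u \<otimes> v \<otimes> w" using l assms mult_left_le_iff[of "inv u \<otimes> l" "v \<otimes> w" u] by (simp add: m_assoc[symmetric])
qed (use assms in simp_all)

lemma hom_meet_join:
  assumes H: "l_group H" and f: "f \<in> hom G H"
    and meet_one: "\<And>g. g \<in> carrier G \<Longrightarrow> f (g \<sqinter>\<^bsub>ord_of G\<^esub> \<one>) = f g \<sqinter>\<^bsub>ord_of H\<^esub> \<one>\<^bsub>H\<^esub>"
    and g: "g \<in> carrier G" "h \<in> carrier G"
  shows "f (g \<sqinter>\<^bsub>ord_of G\<^esub> h) = f g \<sqinter>\<^bsub>ord_of H\<^esub> f h" "f (g \<squnion>\<^bsub>ord_of G\<^esub> h) = f g \<squnion>\<^bsub>ord_of H\<^esub> f h"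
proof -
  interpret H: l_group H by (rule H)
  interpret f: group_hom G H f by unfold_locales (rule f)
  have *: "f (g \<sqinter>\<^bsub>ord_of G\<^esub> h) = f g \<sqinter>\<^bsub>ord_of H\<^esub> f h" if "g \<in> carrier G" "h \<in> carrier G" for g h
    using that meet_eq_meet_one[of g h] H.meet_eq_meet_one[of "f g" "f h"] meet_one by simp
  show "f (g \<sqinter>\<^bsub>ord_of G\<^esub> h) = f g \<sqinter>\<^bsub>ord_of H\<^esub> f h" using * g by simp
  show "f (g \<squnion>\<^bsub>ord_of G\<^esub> h) = f g \<squnion>\<^bsub>ord_of H\<^esub> f h"
    using * g by (simp add: join_eq_inv_meet H.join_eq_inv_meet)
qed

end

section \<open>Formal differences of lists\<close>

context directed_pbck
begin

text \<open>A list stands for the sum of its entries in the negative cone. \<open>neg_part as bs\<close> and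
  \<open>pos_part as bs\<close> stand for \<open>g \<sqinter> 0\<close> and \<open>- (g \<squnion> 0)\<close>, where \<open>g\<close> is the
  difference of \<open>as\<close> and \<open>bs\<close>; \<open>cut\<close> and \<open>rest\<close> do the same for
  a single subtrahend.\<close>

fun rest :: "'a list \<Rightarrow> 'a \<Rightarrow> 'a" where
  "rest [] b = b"
| "rest (a # as) b = rest as (a \<^bold>\<rightarrow> b)"

fun cut :: "'a list \<Rightarrow> 'a \<Rightarrow> 'a list" where
  "cut [] b = []"
| "cut (a # as) b = (b \<^bold>\<rightarrow> a) # cut as (a \<^bold>\<rightarrow> b)"

fun neg_part :: "'a list \<Rightarrow> 'a list \<Rightarrow> 'a list" where
  "neg_part as [] = as"
| "neg_part as (b # bs) = cut (neg_part as bs) b"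

fun pos_part :: "'a list \<Rightarrow> 'a list \<Rightarrow> 'a list" where
  "pos_part as [] = []"
| "pos_part as (b # bs) = rest (neg_part as bs) b # pos_part as bs"

lemma rest_closed [simp]: "set as \<subseteq> carrier A \<Longrightarrow> b \<in> carrier A \<Longrightarrow> rest as b \<in> carrier A"
  by (induction as arbitrary: b) simp_all

lemma cut_closed [simp]: "set as \<subseteq> carrier A \<Longrightarrow> b \<in> carrier A \<Longrightarrow> set (cut as b) \<subseteq> carrier A"
  by (induction as arbitrary: b) simp_all

lemma neg_part_closed [simp]: "set as \<subseteq> carrier A \<Longrightarrow> set bs \<subseteq> carrier A \<Longrightarrow> set (neg_part as bs) \<subseteq> carrier A"
  by (induction bs) simp_all

lemma pos_part_closed [simp]: "set as \<subseteq> carrier A \<Longrightarrow> set bs \<subseteq> carrier A \<Longrightarrow> set (pos_part as bs) \<subseteq> carrier A"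
  by (induction bs) simp_all

lemma le_rest: "set as \<subseteq> carrier A \<Longrightarrow> b \<in> carrier A \<Longrightarrow> b \<preceq> rest as b"
proof (induction as arbitrary: b)
  case (Cons a as)
  then show ?case using trans[of b "a \<^bold>\<rightarrow> b" "rest as (a \<^bold>\<rightarrow> b)"] le_imp by simp
qed (simp add: refl)

text \<open>The head b \<rightarrow> a is disjoint from a \<rightarrow> b by
  \<open>prelinear\<close>, and the final remainder lies above a \<rightarrow> b.\<close>

lemma cut_disjoint:
  "set as \<subseteq> carrier A \<Longrightarrow> b \<in> carrier A \<Longrightarrow> c \<in> set (cut as b) \<Longrightarrow> jn (rest as b) c = \<^bold>1"
proof (induction as arbitrary: b)
  case (Cons a as)
  show ?case
  proof (cases "c = b \<^bold>\<rightarrow> a")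
    case True
    have "jn (a \<^bold>\<rightarrow> b) c = \<^bold>1" using True Cons prelinear by simp
    then show ?thesis using True Cons jn_top_mono[of "a \<^bold>\<rightarrow> b" c "rest as (a \<^bold>\<rightarrow> b)"] le_rest by simp
  next
    case False
    then show ?thesis using Cons by simp
  qed
qed simp

lemma cut_above:
  "set as \<subseteq> carrier A \<Longrightarrow> b \<in> carrier A \<Longrightarrow> c \<in> set (cut as b) \<Longrightarrow> \<exists>a\<in>set as. a \<preceq> c"
proof (induction as arbitrary: b)
  case (Cons a as)
  then show ?case using le_imp by (cases "c = b \<^bold>\<rightarrow> a") (auto, metis imp_closed)
qed simp

lemma pos_part_above:
  "set as \<subseteq> carrier A \<Longrightarrow> set bs \<subseteq> carrier A \<Longrightarrow> d \<in> set (pos_part as bs) \<Longrightarrow> \<exists>b\<in>set bs. b \<preceq> d"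
  using le_rest by (induction bs) auto

lemma parts_disjoint:
  "\<lbrakk>set as \<subseteq> carrier A; set bs \<subseteq> carrier A; c \<in> set (neg_part as bs); d \<in> set (pos_part as bs)\<rbrakk>
    \<Longrightarrow> jn d c = \<^bold>1"
proof (induction bs arbitrary: c d)
  case (Cons b bs)
  have cl: "set (neg_part as bs) \<subseteq> carrier A" "set (pos_part as bs) \<subseteq> carrier A" "b \<in> carrier A"
    using Cons.prems by simp_all
  have c: "c \<in> set (cut (neg_part as bs) b)" using Cons.prems by simp
  then have cC: "c \<in> carrier A" using cut_closed cl by blast
  show ?case
  proof (cases "d = rest (neg_part as bs) b")
    case True
    then show ?thesis using cut_disjoint[OF cl(1,3) c] by simp
  next
    case False
    then have d: "d \<in> set (pos_part as bs)" using Cons.prems by simp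
    \<comment> \<open>Entries of \<open>cut\<close> lie above old entries, so the disjointness from
      the earlier positive parts survives.\<close>
    obtain c' where c': "c' \<in> set (neg_part as bs)" "c' \<preceq> c" using cut_above[OF cl(1,3) c] by blast
    have "jn d c' = \<^bold>1" using Cons c' d by simp
    then have "jn c' d = \<^bold>1" using jn_comm[of c' d] cl c' d by auto
    then have "jn c d = \<^bold>1" using jn_top_mono[of c' d c] c' d cl cC by auto
    then show ?thesis using jn_comm[of c d] cl d cC by auto
  qed
qed simp

end

section \<open>The enveloping group\<close>

text \<open>As simplification rules these would turn equations between functions into equations between
  abstractions, to which the group laws no longer apply.\<close>

lemmas [simp del] = plus_fun_apply zero_fun_apply minus_apply uminus_apply
lemmas pointwise = plus_fun_apply zero_fun_apply minus_apply uminus_apply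

context directed_pbck
begin

text \<open>The sign turns the order-reversing \<open>lam p\<close> into a monotone map with
  nonpositive values. The value 0 off the carrier leaves equality and order of functions to be
  decided on the carrier.\<close>

definition evl :: "'a \<Rightarrow> 'a \<Rightarrow> real" where
  "evl x = (\<lambda>p. if p \<in> carrier A then - lam p x else 0)"

definition S :: "'a list \<Rightarrow> 'a \<Rightarrow> real" where "S as = sum_list (map evl as)"

lemma S_simps [simp]: "S [] = 0" "S (a # as) = evl a + S as" "S (as @ bs) = S as + S bs"
  by (simp_all add: S_def)

lemma evl_le_iff: "x \<in> carrier A \<Longrightarrow> y \<in> carrier A \<Longrightarrow> evl x \<le> evl y \<longleftrightarrow> x \<preceq> y"
proof
  assume *: "x \<in> carrier A" "y \<in> carrier A" "x \<preceq> y"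
  then have "lam p y \<le> lam p x" if "p \<in> carrier A" for p
    using lam_imp[of p y x] lam_nonneg[of p "y \<^bold>\<rightarrow> x"] that by simp
  then show "evl x \<le> evl y" by (simp add: evl_def le_fun_def)
next
  assume *: "x \<in> carrier A" "y \<in> carrier A" "evl x \<le> evl y"
  then have "lam p y \<le> lam p x" if "p \<in> carrier A" for p
    using that le_funD[OF *(3), of p] by (simp add: evl_def)
  then show "x \<preceq> y" using * by (intro le_if_lam_ge)
qed

lemma evl_nonpos: "x \<in> carrier A \<Longrightarrow> evl x \<le> 0"
  using lam_nonneg by (simp add: evl_def le_fun_def pointwise)

lemma S_nonpos: "set as \<subseteq> carrier A \<Longrightarrow> S as \<le> 0"
  by (induction as) (auto intro: add_nonpos_nonpos evl_nonpos)

lemma evl_diff: "x \<in> carrier A \<Longrightarrow> y \<in> carrier A \<Longrightarrow> evl y - evl x = evl (x \<^bold>\<rightarrow> y) - evl (y \<^bold>\<rightarrow> x)"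
  using lam_diff[of _ x y] by (auto simp: evl_def fun_eq_iff pointwise algebra_simps)

lemma S_rest:
  "set as \<subseteq> carrier A \<Longrightarrow> b \<in> carrier A \<Longrightarrow> S as - evl b = S (cut as b) - evl (rest as b)"
proof (induction as arbitrary: b)
  case (Cons a as)
  let ?b = "a \<^bold>\<rightarrow> b"
  have "S (a # as) - evl b = (evl a - evl b) + S as" by simp
  also have "evl a - evl b = evl (b \<^bold>\<rightarrow> a) - evl ?b" using Cons.prems by (intro evl_diff) simp_all
  also have "\<dots> + S as = evl (b \<^bold>\<rightarrow> a) + (S as - evl ?b)" by simp
  also have "S as - evl ?b = S (cut as ?b) - evl (rest as ?b)" using Cons by simp
  finally show ?case by simp
qed simp

lemma S_parts:
  "set as \<subseteq> carrier A \<Longrightarrow> set bs \<subseteq> carrier A \<Longrightarrow> S as - S bs = S (neg_part as bs) - S (pos_part as bs)"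
proof (induction bs)
  case (Cons b bs)
  let ?cs = "neg_part as bs"
  have "S as - S (b # bs) = (S as - S bs) - evl b" by simp
  also have "S as - S bs = S ?cs - S (pos_part as bs)" using Cons by simp
  also have "\<dots> - evl b = (S ?cs - evl b) - S (pos_part as bs)" by simp
  also have "S ?cs - evl b = S (cut ?cs b) - evl (rest ?cs b)" using Cons.prems by (intro S_rest) simp_all
  finally show ?case by simp
qed simp

lemma S_mem_le: "set ds \<subseteq> carrier A \<Longrightarrow> d \<in> set ds \<Longrightarrow> S ds \<le> evl d"
proof (induction ds)
  case (Cons c ds)
  show ?case
  proof (cases "d = c")
    case True
    then show ?thesis using Cons.prems S_nonpos[of ds] add_left_mono[of "S ds" 0 "evl d"] by simp
  next
    case False
    then show ?thesis using Cons evl_nonpos[of c] add_mono[of "evl c" 0 "S ds" "evl d"] by simp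
  qed
qed simp

lemma S_disjoint:
  "set zs \<subseteq> carrier A \<Longrightarrow> d \<in> carrier A \<Longrightarrow> (\<And>z. z \<in> set zs \<Longrightarrow> jn d z = \<^bold>1) \<Longrightarrow> S zs d = 0"
  by (induction zs) (simp_all add: evl_def lam_disjoint pointwise)

text \<open>Evaluate at the point d. There the sum over \<open>zs\<close> vanishes by disjointness,
  while the sum over \<open>ds\<close> is at most \<open>evl d d\<close>, which is - m d by
  \<open>lam_self\<close>; so m d \<le> 0.\<close>

lemma S_le_disjoint_top:
  assumes "set zs \<subseteq> carrier A" "set ds \<subseteq> carrier A" "S zs \<le> S ds"
    and dis: "\<And>d z. d \<in> set ds \<Longrightarrow> z \<in> set zs \<Longrightarrow> jn d z = \<^bold>1" and d: "d \<in> set ds"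
  shows "d = \<^bold>1"
proof -
  have dA: "d \<in> carrier A" using assms by auto
  have "S zs \<le> evl d" using assms S_mem_le[of ds d] by (intro order_trans[OF assms(3)])
  then have "S zs d \<le> evl d d" by (rule le_funD)
  then have "m d \<le> 0" using S_disjoint[of zs d] assms dA by (simp add: evl_def lam_self)
  then show ?thesis using dA measure_nonneg by (intro faithful) (simp_all add: order_antisym)
qed

lemma evl_top: "evl \<^bold>1 = 0"
  by (auto simp: evl_def fun_eq_iff pointwise lam_disjoint jn_def imp_top top_simp)

lemma S_top: "(\<And>d. d \<in> set ds \<Longrightarrow> d = \<^bold>1) \<Longrightarrow> S ds = 0"
proof (induction ds)
  case (Cons d ds)
  then show ?case using Cons.prems[of d] evl_top by simp
qed simp

lemma parts_top_if_S_eq: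
  assumes "set as \<subseteq> carrier A" "set bs \<subseteq> carrier A" "S as = S bs"
    and "d \<in> set (neg_part as bs) \<union> set (pos_part as bs)"
  shows "d = \<^bold>1"
proof -
  have "S (neg_part as bs) = S (pos_part as bs)" using S_parts[of as bs] assms by simp
  moreover have "jn c d = \<^bold>1 \<and> jn d c = \<^bold>1" if "c \<in> set (neg_part as bs)" "d \<in> set (pos_part as bs)" for c d
    using that parts_disjoint[of as bs c d] jn_comm[of c d] assms(1,2)
      subsetD[OF neg_part_closed, of as bs c] subsetD[OF pos_part_closed, of as bs d] by simp
  ultimately show ?thesis
    using assms(1,2,4) S_le_disjoint_top[of "neg_part as bs" "pos_part as bs" d]
      S_le_disjoint_top[of "pos_part as bs" "neg_part as bs" d] by auto
qed

lemma S_parts_le_zero: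
  assumes "set as \<subseteq> carrier A" "set bs \<subseteq> carrier A" "S as \<le> S bs"
  shows "S (pos_part as bs) = 0"
proof (rule S_top)
  fix d assume d: "d \<in> set (pos_part as bs)"
  have "S (neg_part as bs) - S (pos_part as bs) \<le> 0"
    unfolding S_parts[OF assms(1,2), symmetric] using assms(3) by simp
  then have "S (neg_part as bs) \<le> S (pos_part as bs)" by simp
  then show "d = \<^bold>1" using assms d parts_disjoint[of as bs]
      S_le_disjoint_top[of "neg_part as bs" "pos_part as bs" d] by simp
qed

section \<open>The group of differences and its lattice operations\<close>

definition V :: "('a \<Rightarrow> real) set" where
  "V = {S as - S bs | as bs. set as \<subseteq> carrier A \<and> set bs \<subseteq> carrier A}"

lemma V_I: "set as \<subseteq> carrier A \<Longrightarrow> set bs \<subseteq> carrier A \<Longrightarrow> S as - S bs \<in> V"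
  unfolding V_def by blast

lemma V_E:
  assumes "g \<in> V" obtains as bs where "set as \<subseteq> carrier A" "set bs \<subseteq> carrier A" "g = S as - S bs"
  using assms unfolding V_def by blast

lemma V_zero: "0 \<in> V"
  using V_I[of "[]" "[]"] by simp

lemma V_S: "set as \<subseteq> carrier A \<Longrightarrow> S as \<in> V"
  using V_I[of as "[]"] by simp

lemma V_add: "g \<in> V \<Longrightarrow> h \<in> V \<Longrightarrow> g + h \<in> V"
proof (elim V_E)
  fix as bs cs ds assume *: "set as \<subseteq> carrier A" "set bs \<subseteq> carrier A" "g = S as - S bs"
    "set cs \<subseteq> carrier A" "set ds \<subseteq> carrier A" "h = S cs - S ds"
  then have "g + h = S (as @ cs) - S (bs @ ds)" by simp
  then show "g + h \<in> V" using * by (simp only:) (intro V_I; simp)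
qed

lemma V_uminus: "g \<in> V \<Longrightarrow> - g \<in> V"
  by (elim V_E) (simp add: V_I)

lemma V_diff: "g \<in> V \<Longrightarrow> h \<in> V \<Longrightarrow> g - h \<in> V"
  using V_add[of g "- h"] V_uminus by simp

text \<open>The infimum is meant within \<open>V\<close>. A competitor k is itself rewritten as a
  plain sum, and its difference to the candidate is split once more into disjoint parts.\<close>

lemma neg_part_glb:
  assumes as: "set as \<subseteq> carrier A" and bs: "set bs \<subseteq> carrier A" and g: "g = S as - S bs"
  shows "S (neg_part as bs) \<le> g" "S (neg_part as bs) \<le> 0"
    "\<And>k. k \<in> V \<Longrightarrow> k \<le> g \<Longrightarrow> k \<le> 0 \<Longrightarrow> k \<le> S (neg_part as bs)"
proof -
  let ?cs = "neg_part as bs" and ?ds = "pos_part as bs"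
  have cl: "set ?cs \<subseteq> carrier A" "set ?ds \<subseteq> carrier A" using as bs by simp_all
  have g': "g = S ?cs - S ?ds" using S_parts[OF as bs] g by simp
  show "S ?cs \<le> 0" using cl by (intro S_nonpos)
  show "S ?cs \<le> g" using S_nonpos[OF cl(2)] unfolding g' by (simp add: le_diff_eq)
  fix k assume k: "k \<in> V" "k \<le> g" "k \<le> 0"
  obtain us vs where uv: "set us \<subseteq> carrier A" "set vs \<subseteq> carrier A" "k = S us - S vs" using k by (elim V_E)
  \<comment> \<open>As k \<le> 0, its positive part vanishes and k is a sum without
    subtrahend.\<close>
  have "S (pos_part us vs) = 0" using uv k by (intro S_parts_le_zero) simp_all
  then obtain ks where ks: "set ks \<subseteq> carrier A" "k = S ks"
    using uv S_parts[of us vs] neg_part_closed[of us vs] by (metis diff_zero)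
  let ?ns = "neg_part ks ?cs" and ?ps = "pos_part ks ?cs"
  have cl': "set ?ns \<subseteq> carrier A" "set ?ps \<subseteq> carrier A" using ks cl by simp_all
  have diff: "S ks - S ?cs = S ?ns - S ?ps" by (rule S_parts[OF ks(1) cl(1)])
  have "S ?ps = 0"
  proof (rule S_top)
    fix p assume p: "p \<in> set ?ps"
    have "S ks - S ?cs \<le> - S ?ds" using k(2) unfolding ks(2) g' by (simp add: algebra_simps)
    then have "S (?ns @ ?ds) \<le> S ?ps" unfolding diff by (simp add: algebra_simps)
    \<comment> \<open>Entries of \<open>?ps\<close> lie above entries of \<open>?cs\<close>, which
      are disjoint from \<open>?ds\<close>. So they are disjoint from \<open>?ns\<close> and
      \<open>?ds\<close> alike, and the inequality just obtained forces them to be 1.\<close>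
    moreover have "jn q z = \<^bold>1" if q: "q \<in> set ?ps" and z: "z \<in> set (?ns @ ?ds)" for q z
    proof (cases "z \<in> set ?ns")
      case True
      then show ?thesis using parts_disjoint[OF ks(1) cl(1) True q] by simp
    next
      case False
      then have z: "z \<in> set ?ds" using z by simp
      obtain c where c: "c \<in> set ?cs" "c \<preceq> q" using pos_part_above[OF ks(1) cl(1) q] by blast
      have "jn c z = \<^bold>1" using parts_disjoint[OF as bs c(1) z] jn_comm[of c z] c z cl by auto
      then show ?thesis using jn_top_mono[of c z q] c z q cl cl' by auto
    qed
    ultimately show "p = \<^bold>1" using cl cl' p S_le_disjoint_top[of "?ns @ ?ds" ?ps p] by simp
  qed
  then have "S ks - S ?cs \<le> 0" using diff S_nonpos[OF cl'(1)] by simp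
  then show "k \<le> S ?cs" using ks by simp
qed

text \<open>The carrier type \<open>diff_class\<close> holds sets of pairs of lists rather than
  functions, so a function in \<open>V\<close> is represented by its whole fibre. Any pair chosen
  from the fibre recovers the function.\<close>

definition code :: "('a \<Rightarrow> real) \<Rightarrow> 'a diff_class" where
  "code g = {(as, bs). set as \<subseteq> carrier A \<and> set bs \<subseteq> carrier A \<and> S as - S bs = g}"

definition lft :: "'a diff_class \<Rightarrow> 'a list" where "lft X = fst (SOME q. q \<in> X)"
definition rgt :: "'a diff_class \<Rightarrow> 'a list" where "rgt X = snd (SOME q. q \<in> X)"

definition val :: "'a diff_class \<Rightarrow> 'a \<Rightarrow> real" where "val X = S (lft X) - S (rgt X)"

lemma code_repr:
  assumes "g \<in> V"
  shows "set (lft (code g)) \<subseteq> carrier A" "set (rgt (code g)) \<subseteq> carrier A" "val (code g) = g"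
proof -
  obtain q where "q \<in> code g" using assms by (elim V_E) (auto simp: code_def)
  then have "(SOME q. q \<in> code g) \<in> code g" by (rule someI)
  then show "set (lft (code g)) \<subseteq> carrier A" "set (rgt (code g)) \<subseteq> carrier A" "val (code g) = g"
    unfolding lft_def rgt_def val_def by (auto simp: code_def split_beta)
qed

definition envelope :: "'a diff_class ogroup" where
  "envelope = \<lparr>carrier = code ` V, mult = (\<lambda>X Y. code (val X + val Y)), one = code 0,
    ogle = (\<lambda>X Y. val X \<le> val Y)\<rparr>"

lemma envelope_simps [simp]:
  "carrier envelope = code ` V" "one envelope = code 0"
  "g \<in> V \<Longrightarrow> h \<in> V \<Longrightarrow> code g \<otimes>\<^bsub>envelope\<^esub> code h = code (g + h)"
  "g \<in> V \<Longrightarrow> h \<in> V \<Longrightarrow> code g \<unlhd>\<^bsub>envelope\<^esub> code h \<longleftrightarrow> g \<le> h"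
  by (simp_all add: envelope_def code_repr)

lemma group_envelope: "group envelope"
proof (rule groupI)
  show "\<And>X. X \<in> carrier envelope \<Longrightarrow> \<exists>Y\<in>carrier envelope. Y \<otimes>\<^bsub>envelope\<^esub> X = \<one>\<^bsub>envelope\<^esub>"
    using V_uminus by (auto intro!: bexI[of _ "- _"])
qed (auto simp: V_zero V_add add.assoc)

lemma inv_envelope:
  assumes "g \<in> V" shows "inv\<^bsub>envelope\<^esub> (code g) = code (- g)"
  using assms V_uminus by (intro group.inv_equality[OF group_envelope]) auto

lemma glb_exists:
  assumes "g \<in> V" "h \<in> V"
  shows "\<exists>s\<in>V. s \<le> g \<and> s \<le> h \<and> (\<forall>k\<in>V. k \<le> g \<longrightarrow> k \<le> h \<longrightarrow> k \<le> s)"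
proof -
  obtain as bs where *: "set as \<subseteq> carrier A" "set bs \<subseteq> carrier A" "g - h = S as - S bs"
    using V_diff[OF assms] by (elim V_E)
  note glb = neg_part_glb[OF *]
  let ?s = "S (neg_part as bs) + h"
  have "k \<le> ?s" if "k \<in> V" "k \<le> g" "k \<le> h" for k
    using glb(3)[of "k - h"] that assms V_diff[of k h] by (simp add: diff_le_eq)
  moreover have "?s \<in> V" using * assms by (intro V_add V_S) simp_all
  moreover have "?s \<le> g" "?s \<le> h" using glb(1) add_right_mono[OF glb(2), of h] by (simp_all add: le_diff_eq)
  ultimately show ?thesis by (intro bexI[of _ ?s]) simp_all
qed

lemma lub_exists:
  assumes "g \<in> V" "h \<in> V"
  shows "\<exists>s\<in>V. g \<le> s \<and> h \<le> s \<and> (\<forall>k\<in>V. g \<le> k \<longrightarrow> h \<le> k \<longrightarrow> s \<le> k)"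
proof -
  obtain s where s: "s \<in> V" "s \<le> - g" "s \<le> - h" "\<And>k. k \<in> V \<Longrightarrow> k \<le> - g \<Longrightarrow> k \<le> - h \<Longrightarrow> k \<le> s"
    using glb_exists[of "- g" "- h"] V_uminus assms by blast
  have "- s \<le> k" if "k \<in> V" "g \<le> k" "h \<le> k" for k
    using s(4)[of "- k"] V_uminus that by (simp add: minus_le_iff)
  moreover have "g \<le> - s" "h \<le> - s" using s(2,3) by (simp_all add: le_minus_iff)
  ultimately show ?thesis using s(1) V_uminus by (intro bexI[of _ "- s"]) simp_all
qed

lemma l_group_envelope: "l_group envelope"
proof -
  have po: "partial_order (ord_of envelope)"
    by unfold_locales (auto simp: intro: order_trans order_antisym)
  have "lattice (ord_of envelope)"
  proof (intro lattice.intro upper_semilattice.intro lower_semilattice.intro po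
      upper_semilattice_axioms.intro lower_semilattice_axioms.intro)
    fix X Y assume "X \<in> carrier (ord_of envelope)" "Y \<in> carrier (ord_of envelope)"
    then obtain g h where gh: "g \<in> V" "h \<in> V" "X = code g" "Y = code h" by auto
    show "\<exists>s. least (ord_of envelope) s (Upper (ord_of envelope) {X, Y})"
    proof -
      obtain s where "s \<in> V" "g \<le> s" "h \<le> s" "\<And>k. k \<in> V \<Longrightarrow> g \<le> k \<Longrightarrow> h \<le> k \<Longrightarrow> s \<le> k"
        using lub_exists[OF gh(1,2)] by blast
      then show ?thesis using gh unfolding least_def Upper_def by (intro exI[of _ "code s"]) auto
    qed
    show "\<exists>s. greatest (ord_of envelope) s (Lower (ord_of envelope) {X, Y})"
    proof -
      obtain s where "s \<in> V" "s \<le> g" "s \<le> h" "\<And>k. k \<in> V \<Longrightarrow> k \<le> g \<Longrightarrow> k \<le> h \<Longrightarrow> k \<le> s"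
        using glb_exists[OF gh(1,2)] by blast
      then show ?thesis using gh unfolding greatest_def Lower_def by (intro exI[of _ "code s"]) auto
    qed
  qed
  then show ?thesis
    by (intro l_group.intro l_group_axioms.intro group_envelope) (auto simp: V_add)
qed

lemma archimedean_envelope: "archimedean_l_group envelope"
proof (intro archimedean_l_group.intro l_group_envelope archimedean_l_group_axioms.intro)
  interpret G: l_group envelope by (rule l_group_envelope)
  fix X Y assume XY: "X \<in> carrier envelope" "Y \<in> carrier envelope"
    "\<one>\<^bsub>envelope\<^esub> \<unlhd>\<^bsub>envelope\<^esub> X" and pow: "\<And>n::nat. X [^]\<^bsub>envelope\<^esub> n \<unlhd>\<^bsub>envelope\<^esub> Y"
  then obtain g h where gh: "g \<in> V" "h \<in> V" "X = code g" "Y = code h" by auto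
  \<comment> \<open>Membership in \<open>V\<close> is carried through the induction because the
    product rule for codes requires it.\<close>
  have "(\<lambda>p. real n * g p) \<in> V \<and> X [^]\<^bsub>envelope\<^esub> n = code (\<lambda>p. real n * g p)" for n
  proof (induction n)
    case 0
    have "(\<lambda>p. real 0 * g p) = 0" by (simp add: fun_eq_iff pointwise)
    then show ?case using V_zero by simp
  next
    case (Suc n)
    have "(\<lambda>p. real n * g p) + g = (\<lambda>p. real (Suc n) * g p)" by (simp add: fun_eq_iff algebra_simps pointwise)
    then show ?case using Suc gh V_add[of "\<lambda>p. real n * g p" g] by simp
  qed
  then have "real n * g p \<le> h p" for n p
    using pow[of n] gh by (auto simp: le_fun_def)
  then have "g p \<le> 0" for p
    using ex_less_of_nat_mult[of "g p" "h p"] by (metis not_le)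
  moreover have "0 \<le> g" using XY gh V_zero by simp
  ultimately have "g = 0" by (intro order_antisym) (simp_all add: le_fun_def pointwise)
  then show "X = \<one>\<^bsub>envelope\<^esub>" using gh by simp
qed

lemma envelope_meet_one:
  assumes "set as \<subseteq> carrier A" "set bs \<subseteq> carrier A"
  shows "code (S as - S bs) \<sqinter>\<^bsub>ord_of envelope\<^esub> code 0 = code (S (neg_part as bs))"
proof -
  interpret G: l_group envelope by (rule l_group_envelope)
  have V: "S as - S bs \<in> V" "0 \<in> V" "S (neg_part as bs) \<in> V" using assms V_I V_zero V_S by simp_all
  then show ?thesis using neg_part_glb[OF assms HOL.refl]
    by (intro G.meet_eqI) auto
qed

definition emb :: "'a \<Rightarrow> 'a diff_class" where "emb x = code (evl x)"

lemma V_evl: "x \<in> carrier A \<Longrightarrow> evl x \<in> V"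
  using V_S[of "[x]"] by simp

lemma emb_embedding: "pbck_embedding A (neg_cone envelope) emb"
proof -
  interpret G: l_group envelope by (rule l_group_envelope)
  have le: "emb x \<unlhd>\<^bsub>envelope\<^esub> emb y \<longleftrightarrow> x \<preceq> y" if "x \<in> carrier A" "y \<in> carrier A" for x y
    using that by (simp add: emb_def V_evl evl_le_iff)
  \<comment> \<open>For singletons, \<open>neg_part [y] [x]\<close> has the single entry x
    \<rightarrow> y. Since addition of functions commutes, this meet serves for both arrows of the
    cone.\<close>
  have meet: "code (evl y - evl x) \<sqinter>\<^bsub>ord_of envelope\<^esub> code 0 = emb (x \<^bold>\<rightarrow> y)" if "x \<in> carrier A" "y \<in> carrier A" for x y
    using that envelope_meet_one[of "[y]" "[x]"] by (simp add: emb_def)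
  have ops: "emb (x \<^bold>\<rightarrow> y) = emb x \<^bold>\<rightarrow>\<^bsub>neg_cone envelope\<^esub> emb y"
    "emb (x \<leadsto> y) = emb x \<leadsto>\<^bsub>neg_cone envelope\<^esub> emb y" if "x \<in> carrier A" "y \<in> carrier A" for x y
    using that meet[of x y] by (simp_all add: neg_cone_def emb_def inv_envelope V_evl V_uminus imp_eq_simp)
  have inj: "inj_on emb (carrier A)"
    using le by (intro inj_onI antisym) (metis G.le_refl' emb_def envelope_simps(1) image_eqI V_evl)+
  show ?thesis unfolding pbck_embedding_def
    using ops le inj by (auto simp: neg_cone_def emb_def evl_top V_evl V_zero evl_nonpos)
qed

lemma emb_generates: "l_generates (emb ` carrier A) envelope"
proof -
  interpret G: l_group envelope by (rule l_group_envelope)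
  have "H = carrier envelope" if H: "l_subgroup H envelope" "emb ` carrier A \<subseteq> H" for H
  proof -
    have sub: "subgroup H envelope" using H unfolding l_subgroup_def by blast
    have S: "code (S as) \<in> H" if "set as \<subseteq> carrier A" for as
      using that
    proof (induction as)
      case Nil
      then show ?case using subgroup.one_closed[OF sub] by simp
    next
      case (Cons a as)
      then have "emb a \<otimes>\<^bsub>envelope\<^esub> code (S as) \<in> H" using H by (intro subgroup.m_closed[OF sub]) auto
      then show ?case using Cons.prems by (simp add: emb_def V_evl V_S)
    qed
    have "code (S as - S bs) \<in> H" if "set as \<subseteq> carrier A" "set bs \<subseteq> carrier A" for as bs
    proof -
      have "code (S as) \<otimes>\<^bsub>envelope\<^esub> inv\<^bsub>envelope\<^esub> code (S bs) \<in> H"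
        using that S by (intro subgroup.m_closed[OF sub] subgroup.m_inv_closed[OF sub])
      then show ?thesis using that by (simp add: inv_envelope V_S V_uminus)
    qed
    then have "code ` V \<subseteq> H" by (auto elim!: V_E)
    then show ?thesis using subgroup.subset[OF sub] by simp
  qed
  moreover have "emb ` carrier A \<subseteq> carrier envelope" by (auto simp: emb_def V_evl)
  ultimately show ?thesis
    by (subst G.l_generates_iff) blast+
qed

end

section \<open>Uniqueness of the enveloping group\<close>

locale lgroup_embedding = directed_pbck A m + H: l_group H
  for A :: "'a pbck" (structure) and m and H :: "'g ogroup" +
  fixes k :: "'a \<Rightarrow> 'g"
  assumes embedding: "pbck_embedding A (neg_cone H) k"
    and generates: "l_generates (k ` carrier A) H"
begin

lemma k_closed [simp]: "x \<in> carrier A \<Longrightarrow> k x \<in> carrier H"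
  and k_le_one: "x \<in> carrier A \<Longrightarrow> k x \<unlhd>\<^bsub>H\<^esub> \<one>\<^bsub>H\<^esub>"
  and k_top: "k \<^bold>1 = \<one>\<^bsub>H\<^esub>"
  and k_inj: "x \<in> carrier A \<Longrightarrow> y \<in> carrier A \<Longrightarrow> k x = k y \<longleftrightarrow> x = y"
  and k_le_iff: "x \<in> carrier A \<Longrightarrow> y \<in> carrier A \<Longrightarrow> k x \<unlhd>\<^bsub>H\<^esub> k y \<longleftrightarrow> x \<preceq> y"
  and k_imp: "x \<in> carrier A \<Longrightarrow> y \<in> carrier A \<Longrightarrow>
    k (x \<^bold>\<rightarrow> y) = (k y \<otimes>\<^bsub>H\<^esub> inv\<^bsub>H\<^esub> k x) \<sqinter>\<^bsub>ord_of H\<^esub> \<one>\<^bsub>H\<^esub>"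
  and k_simp: "x \<in> carrier A \<Longrightarrow> y \<in> carrier A \<Longrightarrow>
    k (x \<leadsto> y) = (inv\<^bsub>H\<^esub> k x \<otimes>\<^bsub>H\<^esub> k y) \<sqinter>\<^bsub>ord_of H\<^esub> \<one>\<^bsub>H\<^esub>"
  using embedding unfolding pbck_embedding_def neg_cone_def by (auto simp: inj_on_eq_iff)

text \<open>Multiplication by k x undoes the quotient under the meet, from the right for
  \<rightarrow> and from the left for \<leadsto>. Since the arrows coincide in A, comparing the two
  forms yields commutation.\<close>

lemma meet_imp:
  assumes "x \<in> carrier A" "y \<in> carrier A"
  shows "k y \<sqinter>\<^bsub>ord_of H\<^esub> k x = k (x \<^bold>\<rightarrow> y) \<otimes>\<^bsub>H\<^esub> k x" "k y \<sqinter>\<^bsub>ord_of H\<^esub> k x = k x \<otimes>\<^bsub>H\<^esub> k (x \<leadsto> y)"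
proof -
  show "k y \<sqinter>\<^bsub>ord_of H\<^esub> k x = k (x \<^bold>\<rightarrow> y) \<otimes>\<^bsub>H\<^esub> k x"
    using assms by (simp add: k_imp H.meet_mult_right[symmetric] H.m_assoc)
  show "k y \<sqinter>\<^bsub>ord_of H\<^esub> k x = k x \<otimes>\<^bsub>H\<^esub> k (x \<leadsto> y)"
    using assms by (simp add: k_simp H.meet_mult_left[symmetric] H.m_assoc[symmetric])
qed

lemma commute_imp:
  assumes "x \<in> carrier A" "y \<in> carrier A"
  shows "k (x \<^bold>\<rightarrow> y) \<otimes>\<^bsub>H\<^esub> k x = k x \<otimes>\<^bsub>H\<^esub> k (x \<^bold>\<rightarrow> y)"
  using meet_imp[OF assms] imp_eq_simp[OF assms] by simp

lemma k_imp_mult: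
  assumes "x \<in> carrier A" "y \<in> carrier A" "y \<preceq> x"
  shows "k (x \<^bold>\<rightarrow> y) \<otimes>\<^bsub>H\<^esub> k x = k y"
proof -
  have "k y \<sqinter>\<^bsub>ord_of H\<^esub> k x = k y"
    using assms k_le_iff by (intro H.meet_eqI) (simp_all add: H.le_refl')
  then show ?thesis using meet_imp(1)[of x y] assms by simp
qed

lemma k_factor:
  assumes "x \<in> carrier A" "y \<in> carrier A"
  shows "k y = k (x \<^bold>\<rightarrow> y) \<otimes>\<^bsub>H\<^esub> k (jn x y)"
  using k_imp_mult[of "jn x y" y] jn_imp[of x y] jn_upper assms by simp

lemma k_commute:
  assumes x: "x \<in> carrier A" and y: "y \<in> carrier A"
  shows "k x \<otimes>\<^bsub>H\<^esub> k y = k y \<otimes>\<^bsub>H\<^esub> k x"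
proof -
  let ?w = "jn x y" and ?p = "y \<^bold>\<rightarrow> x" and ?q = "x \<^bold>\<rightarrow> y"
  have dis: "jn ?p ?q = \<^bold>1" using prelinear x y by simp
  have fx: "k x = k ?p \<otimes>\<^bsub>H\<^esub> k ?w" using k_factor[of y x] jn_comm[of x y] x y by simp
  have fy: "k y = k ?q \<otimes>\<^bsub>H\<^esub> k ?w" using k_factor[of x y] x y by simp
  \<comment> \<open>Three instances of \<open>commute_imp\<close>: disjointness gives
    \<open>?p\<close> \<rightarrow> \<open>?q\<close> = \<open>?q\<close>, and moreover
    \<open>?w\<close> \<rightarrow> x = \<open>?p\<close> and \<open>?w\<close> \<rightarrow> y =
    \<open>?q\<close>.\<close>
  have pq: "k ?q \<otimes>\<^bsub>H\<^esub> k ?p = k ?p \<otimes>\<^bsub>H\<^esub> k ?q"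
    using commute_imp[of ?p ?q] imp_eq_self[OF _ _ dis] x y by simp
  have wp: "k ?w \<otimes>\<^bsub>H\<^esub> k ?p = k ?p \<otimes>\<^bsub>H\<^esub> k ?w"
    using commute_imp[of ?w x] jn_imp[of y x] jn_comm[of x y] x y by simp
  have wq: "k ?w \<otimes>\<^bsub>H\<^esub> k ?q = k ?q \<otimes>\<^bsub>H\<^esub> k ?w"
    using commute_imp[of ?w y] jn_imp[of x y] x y by simp
  have c: "k ?p \<in> carrier H" "k ?q \<in> carrier H" "k ?w \<in> carrier H" using x y by simp_all
  have "k x \<otimes>\<^bsub>H\<^esub> k y = k ?p \<otimes>\<^bsub>H\<^esub> (k ?w \<otimes>\<^bsub>H\<^esub> k ?q) \<otimes>\<^bsub>H\<^esub> k ?w"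
    unfolding fx fy using c by (simp add: H.m_assoc)
  also have "\<dots> = (k ?q \<otimes>\<^bsub>H\<^esub> k ?p) \<otimes>\<^bsub>H\<^esub> k ?w \<otimes>\<^bsub>H\<^esub> k ?w"
    unfolding wq pq using c by (simp add: H.m_assoc)
  also have "\<dots> = k ?q \<otimes>\<^bsub>H\<^esub> (k ?w \<otimes>\<^bsub>H\<^esub> k ?p) \<otimes>\<^bsub>H\<^esub> k ?w"
    unfolding wp using c by (simp add: H.m_assoc)
  also have "\<dots> = k y \<otimes>\<^bsub>H\<^esub> k x"
    unfolding fx fy using c by (simp add: H.m_assoc)
  finally show ?thesis .
qed

sublocale H: comm_group H
  using generates k_commute by (intro H.comm_if_generators_commute[of "k ` carrier A"]) auto

section \<open>Products in the group compared with sums of functions\<close>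

definition P :: "'a list \<Rightarrow> 'g" where "P as = foldr (\<lambda>a r. k a \<otimes>\<^bsub>H\<^esub> r) as \<one>\<^bsub>H\<^esub>"

lemma P_simps [simp]: "P [] = \<one>\<^bsub>H\<^esub>" "P (a # as) = k a \<otimes>\<^bsub>H\<^esub> P as"
  by (simp_all add: P_def)

lemma P_closed [simp]: "set as \<subseteq> carrier A \<Longrightarrow> P as \<in> carrier H"
  by (induction as) simp_all

lemma P_append: "set as \<subseteq> carrier A \<Longrightarrow> set bs \<subseteq> carrier A \<Longrightarrow> P (as @ bs) = P as \<otimes>\<^bsub>H\<^esub> P bs"
  by (induction as) (simp_all add: H.m_assoc)

lemma P_le_one: "set as \<subseteq> carrier A \<Longrightarrow> P as \<unlhd>\<^bsub>H\<^esub> \<one>\<^bsub>H\<^esub>"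
proof (induction as)
  case (Cons a as)
  then show ?case
    using H.mult_right_mono[of "k a" "\<one>\<^bsub>H\<^esub>" "P as"] k_le_one H.le_trans'[of "k a \<otimes>\<^bsub>H\<^esub> P as" "P as" "\<one>\<^bsub>H\<^esub>"] by simp
qed (simp add: H.le_refl')

lemma P_mem_ge: "set ds \<subseteq> carrier A \<Longrightarrow> d \<in> set ds \<Longrightarrow> P ds \<unlhd>\<^bsub>H\<^esub> k d"
proof (induction ds)
  case (Cons c ds)
  then have cl: "k c \<in> carrier H" "P ds \<in> carrier H" "k d \<in> carrier H" by auto
  show ?case
  proof (cases "d = c")
    case True
    then show ?thesis using cl Cons.prems P_le_one[of ds] H.mult_left_mono[of "P ds" "\<one>\<^bsub>H\<^esub>" "k c"] by simp
  next
    case False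
    then have "P ds \<unlhd>\<^bsub>H\<^esub> k d" using Cons by simp
    moreover have "k c \<otimes>\<^bsub>H\<^esub> P ds \<unlhd>\<^bsub>H\<^esub> P ds"
      using cl Cons.prems k_le_one[of c] H.mult_right_mono[of "k c" "\<one>\<^bsub>H\<^esub>" "P ds"] by simp
    ultimately show ?thesis using cl H.le_trans'[of "k c \<otimes>\<^bsub>H\<^esub> P ds" "P ds" "k d"] by simp
  qed
qed simp

text \<open>Both sides are the meet of k a and k b.\<close>

lemma k_factor_exchange:
  assumes "a \<in> carrier A" "b \<in> carrier A"
  shows "k a \<otimes>\<^bsub>H\<^esub> k (a \<^bold>\<rightarrow> b) = k b \<otimes>\<^bsub>H\<^esub> k (b \<^bold>\<rightarrow> a)"
  using meet_imp(1)[of a b] meet_imp(1)[of b a] assms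
  by (simp add: H.m_comm meet_comm)

lemma P_rest:
  "set as \<subseteq> carrier A \<Longrightarrow> b \<in> carrier A \<Longrightarrow> P as \<otimes>\<^bsub>H\<^esub> k (rest as b) = k b \<otimes>\<^bsub>H\<^esub> P (cut as b)"
proof (induction as arbitrary: b)
  case (Cons a as)
  let ?b = "a \<^bold>\<rightarrow> b"
  have IH: "P as \<otimes>\<^bsub>H\<^esub> k (rest as ?b) = k ?b \<otimes>\<^bsub>H\<^esub> P (cut as ?b)" using Cons by simp
  have "P (a # as) \<otimes>\<^bsub>H\<^esub> k (rest (a # as) b) = k a \<otimes>\<^bsub>H\<^esub> (P as \<otimes>\<^bsub>H\<^esub> k (rest as ?b))"
    using Cons.prems by (simp add: H.m_assoc)
  also have "\<dots> = (k a \<otimes>\<^bsub>H\<^esub> k ?b) \<otimes>\<^bsub>H\<^esub> P (cut as ?b)" unfolding IH using Cons.prems by (simp add: H.m_assoc)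
  also have "k a \<otimes>\<^bsub>H\<^esub> k ?b = k b \<otimes>\<^bsub>H\<^esub> k (b \<^bold>\<rightarrow> a)" using Cons.prems by (intro k_factor_exchange) simp_all
  finally show ?case using Cons.prems by (simp add: H.m_assoc)
qed simp

lemma P_parts:
  "set as \<subseteq> carrier A \<Longrightarrow> set bs \<subseteq> carrier A
    \<Longrightarrow> P as \<otimes>\<^bsub>H\<^esub> P (pos_part as bs) = P bs \<otimes>\<^bsub>H\<^esub> P (neg_part as bs)"
proof (induction bs)
  case Nil
  then show ?case by simp
next
  case (Cons b bs)
  let ?cs = "neg_part as bs" and ?ds = "pos_part as bs"
  have cl: "P as \<in> carrier H" "P bs \<in> carrier H" "P ?cs \<in> carrier H" "P ?ds \<in> carrier H" "k b \<in> carrier H"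
    "k (rest ?cs b) \<in> carrier H" "P (cut ?cs b) \<in> carrier H"
    using Cons.prems by simp_all
  have IH: "P as \<otimes>\<^bsub>H\<^esub> P ?ds = P bs \<otimes>\<^bsub>H\<^esub> P ?cs" using Cons by simp
  have r: "P ?cs \<otimes>\<^bsub>H\<^esub> k (rest ?cs b) = k b \<otimes>\<^bsub>H\<^esub> P (cut ?cs b)" using Cons.prems by (intro P_rest) simp_all
  have "P as \<otimes>\<^bsub>H\<^esub> P (pos_part as (b # bs)) = (P as \<otimes>\<^bsub>H\<^esub> P ?ds) \<otimes>\<^bsub>H\<^esub> k (rest ?cs b)"
    using cl by (simp add: H.m_ac)
  also have "\<dots> = P bs \<otimes>\<^bsub>H\<^esub> (P ?cs \<otimes>\<^bsub>H\<^esub> k (rest ?cs b))" unfolding IH using cl by (simp add: H.m_assoc)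
  also have "\<dots> = P (b # bs) \<otimes>\<^bsub>H\<^esub> P (neg_part as (b # bs))" unfolding r using cl by (simp add: H.m_ac)
  finally show ?case .
qed

lemma k_disjoint:
  assumes "c \<in> carrier A" "d \<in> carrier A" "jn d c = \<^bold>1"
  shows "k c \<sqinter>\<^bsub>ord_of H\<^esub> k d = k c \<otimes>\<^bsub>H\<^esub> k d"
  using meet_imp(1)[of d c] imp_eq_self[of d c] assms by simp

lemma P_disjoint:
  assumes cs: "set cs \<subseteq> carrier A" and ds: "set ds \<subseteq> carrier A"
    and dis: "\<And>c d. c \<in> set cs \<Longrightarrow> d \<in> set ds \<Longrightarrow> jn d c = \<^bold>1"
  shows "P cs \<sqinter>\<^bsub>ord_of H\<^esub> P ds = P cs \<otimes>\<^bsub>H\<^esub> P ds"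
proof -
  have one: "\<one>\<^bsub>H\<^esub> \<sqinter>\<^bsub>ord_of H\<^esub> g = g" if "g \<in> carrier H" "g \<unlhd>\<^bsub>H\<^esub> \<one>\<^bsub>H\<^esub>" for g
    using that by (intro H.meet_eqI) (simp_all add: H.le_refl')
  have single: "P cs \<sqinter>\<^bsub>ord_of H\<^esub> k d = P cs \<otimes>\<^bsub>H\<^esub> k d"
    if "d \<in> carrier A" "\<And>c. c \<in> set cs \<Longrightarrow> jn d c = \<^bold>1" for d
    using cs that
  proof (induction cs)
    case (Cons c cs)
    then show ?case by (simp, intro H.disjoint_mult) (simp_all add: k_le_one P_le_one k_disjoint)
  qed (simp add: one k_le_one)
  show ?thesis using ds dis
  proof (induction ds)
    case Nil
    then show ?case using cs one[of "P cs"] P_le_one by (simp add: meet_comm)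
  next
    case (Cons d ds)
    have "(k d \<otimes>\<^bsub>H\<^esub> P ds) \<sqinter>\<^bsub>ord_of H\<^esub> P cs = k d \<otimes>\<^bsub>H\<^esub> P ds \<otimes>\<^bsub>H\<^esub> P cs"
      using Cons cs single[of d]
      by (intro H.disjoint_mult) (simp_all add: k_le_one P_le_one meet_comm[of _ _ "P cs"] H.m_comm)
    then show ?case using Cons.prems cs by (simp add: meet_comm[of _ _ "P cs"] H.m_comm[of "P cs"])
  qed
qed

lemma diff_parts:
  assumes "set as \<subseteq> carrier A" "set bs \<subseteq> carrier A"
  shows "P as \<otimes>\<^bsub>H\<^esub> inv\<^bsub>H\<^esub> P bs = P (neg_part as bs) \<otimes>\<^bsub>H\<^esub> inv\<^bsub>H\<^esub> P (pos_part as bs)"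
proof -
  let ?c = "P (neg_part as bs)" and ?d = "P (pos_part as bs)"
  have cl: "P as \<in> carrier H" "P bs \<in> carrier H" "?c \<in> carrier H" "?d \<in> carrier H" using assms by simp_all
  have "P as \<otimes>\<^bsub>H\<^esub> inv\<^bsub>H\<^esub> P bs = (P as \<otimes>\<^bsub>H\<^esub> ?d) \<otimes>\<^bsub>H\<^esub> inv\<^bsub>H\<^esub> ?d \<otimes>\<^bsub>H\<^esub> inv\<^bsub>H\<^esub> P bs"
    using cl by (simp add: H.m_assoc)
  also have "\<dots> = inv\<^bsub>H\<^esub> P bs \<otimes>\<^bsub>H\<^esub> (P bs \<otimes>\<^bsub>H\<^esub> ?c) \<otimes>\<^bsub>H\<^esub> inv\<^bsub>H\<^esub> ?d"
    unfolding P_parts[OF assms] using cl by (simp add: H.m_ac)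
  also have "\<dots> = ?c \<otimes>\<^bsub>H\<^esub> inv\<^bsub>H\<^esub> ?d" using cl by (simp add: H.m_assoc[symmetric])
  finally show ?thesis .
qed

text \<open>With c and d the disjoint parts, the meet of c / d with d / d is (c \<sqinter> d) / d =
  c. The same list appears in \<open>envelope_meet_one\<close>, which is why \<open>lift\<close>
  preserves meets.\<close>

lemma meet_one_parts:
  assumes "set as \<subseteq> carrier A" "set bs \<subseteq> carrier A"
  shows "(P as \<otimes>\<^bsub>H\<^esub> inv\<^bsub>H\<^esub> P bs) \<sqinter>\<^bsub>ord_of H\<^esub> \<one>\<^bsub>H\<^esub> = P (neg_part as bs)"
proof -
  let ?c = "P (neg_part as bs)" and ?d = "P (pos_part as bs)"
  have cl: "?c \<in> carrier H" "?d \<in> carrier H" using assms by simp_all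
  have "(?c \<otimes>\<^bsub>H\<^esub> inv\<^bsub>H\<^esub> ?d) \<sqinter>\<^bsub>ord_of H\<^esub> (?d \<otimes>\<^bsub>H\<^esub> inv\<^bsub>H\<^esub> ?d) = (?c \<sqinter>\<^bsub>ord_of H\<^esub> ?d) \<otimes>\<^bsub>H\<^esub> inv\<^bsub>H\<^esub> ?d"
    using cl by (intro H.meet_mult_right) simp_all
  also have "?c \<sqinter>\<^bsub>ord_of H\<^esub> ?d = ?c \<otimes>\<^bsub>H\<^esub> ?d"
    using assms parts_disjoint[OF assms] by (intro P_disjoint) simp_all
  finally show ?thesis using cl diff_parts[OF assms] by (simp add: H.m_assoc)
qed

lemma P_eq_one: "(\<And>d. d \<in> set ds \<Longrightarrow> d = \<^bold>1) \<Longrightarrow> P ds = \<one>\<^bsub>H\<^esub>"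
proof (induction ds)
  case (Cons d ds)
  then show ?case using Cons.prems[of d] k_top by simp
qed simp

lemma P_eq_one_imp:
  assumes "set ds \<subseteq> carrier A" "P ds = \<one>\<^bsub>H\<^esub>" "d \<in> set ds" shows "d = \<^bold>1"
proof -
  have d: "d \<in> carrier A" using assms by auto
  then have "k d = k \<^bold>1"
    using P_mem_ge[OF assms(1,3)] k_le_one[OF d] assms(2) k_top by (intro H.le_antisym') simp_all
  then show ?thesis using d k_inj by simp
qed

text \<open>Either equality holds exactly when all entries of both disjoint parts are 1, a condition
  on A alone. Hence the two groups identify the same lists.\<close>

lemma P_eq_iff:
  assumes as: "set as \<subseteq> carrier A" and bs: "set bs \<subseteq> carrier A"
  shows "P as = P bs \<longleftrightarrow> S as = S bs"
proof
  assume "S as = S bs"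
  then have "P (neg_part as bs) = \<one>\<^bsub>H\<^esub>" "P (pos_part as bs) = \<one>\<^bsub>H\<^esub>"
    using parts_top_if_S_eq[OF as bs] by (auto intro: P_eq_one)
  then show "P as = P bs" using P_parts[OF as bs] as bs by simp
next
  let ?c = "neg_part as bs" and ?d = "pos_part as bs"
  assume "P as = P bs"
  then have "P ?c = \<one>\<^bsub>H\<^esub>"
    using meet_one_parts[OF as bs] as bs H.meet_eqI[of "\<one>\<^bsub>H\<^esub>" "\<one>\<^bsub>H\<^esub>" "\<one>\<^bsub>H\<^esub>"] H.le_refl' by simp
  moreover have "P ?d = \<one>\<^bsub>H\<^esub>"
    using P_parts[OF as bs] \<open>P as = P bs\<close> \<open>P ?c = \<one>\<^bsub>H\<^esub>\<close> as bs by simp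
  ultimately have "S ?c = 0" "S ?d = 0"
    using P_eq_one_imp[of ?c] P_eq_one_imp[of ?d] as bs by (auto intro!: S_top)
  then show "S as = S bs" using S_parts[OF as bs] by simp
qed

definition lift :: "'a diff_class \<Rightarrow> 'g" where "lift X = P (lft X) \<otimes>\<^bsub>H\<^esub> inv\<^bsub>H\<^esub> P (rgt X)"

text \<open>Cross-multiplied, this is \<open>P_eq_iff\<close> for concatenated lists. One direction
  makes \<open>lift\<close> independent of the chosen representatives, the other makes it
  injective.\<close>

lemma diff_eq_iff:
  assumes "set as \<subseteq> carrier A" "set bs \<subseteq> carrier A" "set cs \<subseteq> carrier A" "set ds \<subseteq> carrier A"
  shows "P as \<otimes>\<^bsub>H\<^esub> inv\<^bsub>H\<^esub> P bs = P cs \<otimes>\<^bsub>H\<^esub> inv\<^bsub>H\<^esub> P ds \<longleftrightarrow> S as - S bs = S cs - S ds"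
proof -
  have aux: "a \<otimes>\<^bsub>H\<^esub> inv\<^bsub>H\<^esub> b = c \<otimes>\<^bsub>H\<^esub> inv\<^bsub>H\<^esub> d \<longleftrightarrow> a \<otimes>\<^bsub>H\<^esub> d = c \<otimes>\<^bsub>H\<^esub> b"
    if "a \<in> carrier H" "b \<in> carrier H" "c \<in> carrier H" "d \<in> carrier H" for a b c d
  proof
    assume eq: "a \<otimes>\<^bsub>H\<^esub> inv\<^bsub>H\<^esub> b = c \<otimes>\<^bsub>H\<^esub> inv\<^bsub>H\<^esub> d"
    have "a \<otimes>\<^bsub>H\<^esub> d = (a \<otimes>\<^bsub>H\<^esub> inv\<^bsub>H\<^esub> b) \<otimes>\<^bsub>H\<^esub> b \<otimes>\<^bsub>H\<^esub> d" using that by (simp add: H.m_assoc)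
    also have "\<dots> = c \<otimes>\<^bsub>H\<^esub> (inv\<^bsub>H\<^esub> d \<otimes>\<^bsub>H\<^esub> d) \<otimes>\<^bsub>H\<^esub> b"
      unfolding eq using that by (simp only: H.m_ac H.m_closed H.inv_closed)
    finally show "a \<otimes>\<^bsub>H\<^esub> d = c \<otimes>\<^bsub>H\<^esub> b" using that by simp
  next
    assume eq: "a \<otimes>\<^bsub>H\<^esub> d = c \<otimes>\<^bsub>H\<^esub> b"
    have "a \<otimes>\<^bsub>H\<^esub> inv\<^bsub>H\<^esub> b = (a \<otimes>\<^bsub>H\<^esub> d) \<otimes>\<^bsub>H\<^esub> inv\<^bsub>H\<^esub> d \<otimes>\<^bsub>H\<^esub> inv\<^bsub>H\<^esub> b" using that by (simp add: H.m_assoc)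
    also have "\<dots> = c \<otimes>\<^bsub>H\<^esub> (b \<otimes>\<^bsub>H\<^esub> inv\<^bsub>H\<^esub> b) \<otimes>\<^bsub>H\<^esub> inv\<^bsub>H\<^esub> d"
      unfolding eq using that by (simp only: H.m_ac H.m_closed H.inv_closed)
    finally show "a \<otimes>\<^bsub>H\<^esub> inv\<^bsub>H\<^esub> b = c \<otimes>\<^bsub>H\<^esub> inv\<^bsub>H\<^esub> d" using that by simp
  qed
  have "P as \<otimes>\<^bsub>H\<^esub> inv\<^bsub>H\<^esub> P bs = P cs \<otimes>\<^bsub>H\<^esub> inv\<^bsub>H\<^esub> P ds \<longleftrightarrow> P (as @ ds) = P (cs @ bs)"
    using assms aux by (simp add: P_append)
  also have "\<dots> \<longleftrightarrow> S as + S ds = S cs + S bs" using assms P_eq_iff[of "as @ ds" "cs @ bs"] by simp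
  finally show ?thesis by (simp add: diff_eq_eq add_diff_eq eq_diff_eq diff_add_eq)
qed

lemma lift_code:
  assumes "set as \<subseteq> carrier A" "set bs \<subseteq> carrier A"
  shows "lift (code (S as - S bs)) = P as \<otimes>\<^bsub>H\<^esub> inv\<^bsub>H\<^esub> P bs"
proof -
  have V: "S as - S bs \<in> V" using assms by (rule V_I)
  show ?thesis unfolding lift_def
    using code_repr[OF V] assms by (subst diff_eq_iff) (simp_all add: val_def)
qed

lemma lift_hom: "lift \<in> hom envelope H"
proof (rule homI)
  fix X assume "X \<in> carrier envelope"
  then obtain as bs where "set as \<subseteq> carrier A" "set bs \<subseteq> carrier A" "X = code (S as - S bs)"
    by (auto elim!: V_E)
  then show "lift X \<in> carrier H" by (simp add: lift_code)
next
  fix X Y assume "X \<in> carrier envelope" "Y \<in> carrier envelope"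
  then obtain as bs cs ds where *: "set as \<subseteq> carrier A" "set bs \<subseteq> carrier A" "X = code (S as - S bs)"
    "set cs \<subseteq> carrier A" "set ds \<subseteq> carrier A" "Y = code (S cs - S ds)"
    by (auto elim!: V_E)
  have "X \<otimes>\<^bsub>envelope\<^esub> Y = code (S (as @ cs) - S (bs @ ds))"
    using * by (simp add: V_I add_diff_add)
  then have "lift (X \<otimes>\<^bsub>envelope\<^esub> Y) = P (as @ cs) \<otimes>\<^bsub>H\<^esub> inv\<^bsub>H\<^esub> P (bs @ ds)"
    using * lift_code[of "as @ cs" "bs @ ds"] by (simp only:) simp
  then show "lift (X \<otimes>\<^bsub>envelope\<^esub> Y) = lift X \<otimes>\<^bsub>H\<^esub> lift Y"
    using * by (simp add: lift_code P_append H.inv_mult H.m_ac)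
qed

lemma lift_meet_one:
  assumes "X \<in> carrier envelope"
  shows "lift (X \<sqinter>\<^bsub>ord_of envelope\<^esub> \<one>\<^bsub>envelope\<^esub>) = lift X \<sqinter>\<^bsub>ord_of H\<^esub> \<one>\<^bsub>H\<^esub>"
proof -
  obtain as bs where *: "set as \<subseteq> carrier A" "set bs \<subseteq> carrier A" "X = code (S as - S bs)"
    using assms by (auto elim!: V_E)
  then show ?thesis
    using lift_code[of "neg_part as bs" "[]"] by (simp add: lift_code envelope_meet_one meet_one_parts)
qed

lemma lift_emb: "x \<in> carrier A \<Longrightarrow> lift (emb x) = k x"
  using lift_code[of "[x]" "[]"] by (simp add: emb_def)

lemma lift_iso: "lift \<in> l_iso envelope H"
proof -
  interpret G: l_group envelope by (rule l_group_envelope)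
  interpret lift: group_hom envelope H lift by unfold_locales (rule lift_hom)
  note lattice = G.hom_meet_join[OF H.l_group_axioms lift_hom lift_meet_one]
  have "inj_on lift (carrier envelope)"
  proof (rule inj_onI)
    fix X Y assume XY: "X \<in> carrier envelope" "Y \<in> carrier envelope" "lift X = lift Y"
    then obtain as bs cs ds where "set as \<subseteq> carrier A" "set bs \<subseteq> carrier A" "X = code (S as - S bs)"
      "set cs \<subseteq> carrier A" "set ds \<subseteq> carrier A" "Y = code (S cs - S ds)"
      by (auto elim!: V_E)
    then show "X = Y" using XY(3) diff_eq_iff[of as bs cs ds] by (simp add: lift_code)
  qed
  moreover have "lift ` carrier envelope = carrier H"
  proof -
    \<comment> \<open>Surjectivity: the image is closed under the meet with the unit by
      \<open>lift_meet_one\<close> and contains the generators, so it is all of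
      \<open>H\<close>.\<close>
    have "l_subgroup (lift ` carrier envelope) H"
      using lift.img_is_subgroup lift_meet_one[symmetric]
      by (intro H.l_subgroupI) (auto intro!: imageI simp del: envelope_simps)
    moreover have "k ` carrier A \<subseteq> lift ` carrier envelope"
      using V_evl by (auto simp: lift_emb[symmetric] emb_def intro!: imageI)
    moreover have "k ` carrier A \<subseteq> carrier H" by auto
    ultimately show ?thesis using generates H.l_generates_iff by blast
  qed
  ultimately show ?thesis
    unfolding l_iso_def iso_def bij_betw_def using lift_hom lattice by blast
qed

end

theorem theorem4p9:
  fixes A :: "'a pbck" and m :: "'a \<Rightarrow> real"
  defines "Q \<equiv> pbck_quot A (Ker0 A m)"
  assumes "pseudo_bck A"
    and "unbounded A"
    and "downwards_directed A"
    and "bck_measure A m"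
  shows "(\<forall>X\<in>carrier Q. \<forall>Y\<in>carrier Q. X \<^bold>\<rightarrow>\<^bsub>Q\<^esub> Y = X \<leadsto>\<^bsub>Q\<^esub> Y) \<and>
    (\<exists>(G :: 'a set diff_class ogroup) e. arch_l_envelope Q G e \<and>
      (\<forall>(H :: 'g ogroup) h. arch_l_envelope Q H h \<longrightarrow>
        (\<exists>f\<in>l_iso G H. \<forall>X\<in>carrier Q. f (e X) = h X)))"
proof -
  interpret A: measured_pbck A m
    using assms(2,5) by (simp add: measured_pbck_def measured_pbck_axioms_def)
  interpret Q: directed_pbck Q A.qm
    unfolding Q_def directed_pbck_def directed_pbck_axioms_def faithful_pbck_def faithful_pbck_axioms_def
      measured_pbck_def measured_pbck_axioms_def
    using A.quot_pseudo_bck A.quot_measure A.quot_faithful A.quot_directed[OF assms(4)] by blast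
  have env: "arch_l_envelope Q Q.envelope Q.emb"
    unfolding arch_l_envelope_def
    using Q.archimedean_envelope Q.emb_embedding Q.emb_generates by blast
  have "\<exists>f\<in>l_iso Q.envelope H. \<forall>X\<in>carrier Q. f (Q.emb X) = h X"
    if "arch_l_envelope Q H h" for H :: "'g ogroup" and h
  proof -
    interpret H: lgroup_embedding Q A.qm H h
      using that Q.directed_pbck_axioms
      unfolding arch_l_envelope_def lgroup_embedding_def lgroup_embedding_axioms_def archimedean_l_group_def
      by blast
    show ?thesis using H.lift_iso H.lift_emb by blast
  qed
  then show ?thesis using Q.imp_eq_simp env by blast
qed

end
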